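(* In the structured linear-concave-affine control setting of the context, the control-to-state map $u\mapsto x_u$ is affine and weak-$*$ continuous from $\mathcal U$ (with the weak-$*$ topology of $L^\infty(0,T;\mathbb R^m)$) to $C([0,T];\mathbb R^n)$. Consequently, $J$ is concave and weak-$*$ upper semicontinuous on $\mathcal U$, and $\mathcal C$ is affine and weak-$*$ continuous on $\mathcal U$.
   Context: Structured class. Fix $T>0$, $x_0\in\mathbb R^n$, and a nonempty, compact, convex set $U\subset\mathbb R^m$. Let $\mathcal U=\{u\in L^\infty(0,T;\mathbb R^m): u(t)\in U\text{ for a.e. }t\}$. For $u\in\mathcal U$ let $x_u$ be the unique solution of $\dot x(t)=A(t)x(t)+B(t)u(t)$, $x(0)=x_0$, where $A,B$ are measurable and bounded matrix functions of sizes $n\times n$ and $n\times m$. The payoff is $J(u)=\int_0^T f(t,x_u(t),u(t))\,dt+\phi(x_u(T))$, where: $f:[0,T]\times\mathbb R^n\times\mathbb R^m\to\mathbb R$ is measurable in $t$ for each $(x,u)$; $f(t,\cdot,\cdot)$ is $C^1$ for a.e. $t$ and concave (and upper semicontinuous); $|f(t,x,u)|\le c(1+\|x\|^2+\|u\|^2)$ on $[0,T]\times\mathbb R^n\times U$; $\phi\in C^1(\mathbb R^n)$ is concave (and upper semicontinuous) with $|\phi(x)|\le c(1+\|x\|^2)$, for some $c>0$. Moreover the structured-class assumption includes the hypothesis that $J$ is weak-$*$ upper semicontinuous on $\mathcal U$. The constraint functional is $\mathcal C(u)=\int_0^T h(t,x_u(t),u(t))\,dt$ with $h(t,x,u)=a(t)^\top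 x+b(t)^\top u+c_0(t)$, where $a,b,c_0$ are measurable and bounded. $C([0,T];\mathbb R^n)$ carries the supremum norm; the weak-$*$ topology is that of $L^\infty=(L^1)^*$. "Affine" on the convex set $\mathcal U$ means preserving convex combinations. *)

theory Defs
  imports "HOL-Analysis.Analysis"
begin

text \<open>
  Elements of \<open>L\<^sup>p(0,T)\<close> are represented by functions that are Lebesgue measurable on
  \<open>[0,T]\<close>; classes modulo a.e. equality are not formed. Functions equal a.e. on \<open>[0,T]\<close> are
  topologically indistinguishable in the topology \<open>weak_star\<close> below, so a continuous map from it
  into a Hausdorff space, or an upper semicontinuous real function on it, automatically descends
  to the classes.
\<close>

definition Linf :: "real \<Rightarrow> (real \<Rightarrow> 'v::euclidean_space) set" where
  "Linf T = {u. u \<in> borel_measurable (lebesgue_on {0..T}) \<and>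
                (\<exists>M. AE t in lebesgue_on {0..T}. norm (u t) \<le> M)}"

definition weak_star :: "real \<Rightarrow> (real \<Rightarrow> 'v::euclidean_space) topology" where
  "weak_star T = topology_generated_by
     {{u \<in> Linf T. (LINT t|lebesgue_on {0..T}. g t \<bullet> u t) \<in> W} | g W.
        integrable (lebesgue_on {0..T}) g \<and> open W}"

definition admissible :: "real \<Rightarrow> 'v::euclidean_space set \<Rightarrow> (real \<Rightarrow> 'v) set" where
  "admissible T U = {u \<in> Linf T. AE t in lebesgue_on {0..T}. u t \<in> U}"

definition weak_star_on :: "real \<Rightarrow> (real \<Rightarrow> 'v::euclidean_space) set \<Rightarrow> (real \<Rightarrow> 'v) topology" where
  "weak_star_on T K = subtopology (weak_star T) K"

text \<open>The space \<open>C([0,T])\<close> with the supremum metric; its elements are \<open>undefined\<close> outside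
  \<open>[0,T]\<close>.\<close>

definition C_space :: "real \<Rightarrow> (real \<Rightarrow> 'v::euclidean_space) metric" where
  "C_space T = cfunspace (top_of_set {0..T}) euclidean_metric"

text \<open>The index pairs \<open>(s,t)\<close> below are the non-overlapping intervals \<open>[s,t]\<close>.\<close>

definition absolutely_continuous_on_ivl :: "real \<Rightarrow> real \<Rightarrow> (real \<Rightarrow> 'v::euclidean_space) \<Rightarrow> bool" where
  "absolutely_continuous_on_ivl a b x \<longleftrightarrow>
     (\<forall>\<epsilon>>0. \<exists>\<delta>>0. \<forall>I. finite I \<and> (\<forall>(s,t)\<in>I. a \<le> s \<and> s \<le> t \<and> t \<le> b) \<and>
        disjoint_family_on (\<lambda>(s,t). {s<..<t}) I \<and> (\<Sum>(s,t)\<in>I. t - s) < \<delta>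
        \<longrightarrow> (\<Sum>(s,t)\<in>I. norm (x t - x s)) < \<epsilon>)"

text \<open>Caratheodory solutions of \<open>x' = A x + B u\<close>, \<open>x(0) = x0\<close> on \<open>[0,T]\<close>. The coefficients are
  only measurable, so the equation holds almost everywhere.\<close>

definition is_trajectory ::
    "real \<Rightarrow> real^'n \<Rightarrow> (real \<Rightarrow> real^'n^'n) \<Rightarrow> (real \<Rightarrow> real^'m^'n) \<Rightarrow>
     (real \<Rightarrow> real^'m) \<Rightarrow> (real \<Rightarrow> real^'n) \<Rightarrow> bool" where
  "is_trajectory T x0 A B u x \<longleftrightarrow>
     absolutely_continuous_on_ivl 0 T x \<and> x 0 = x0 \<and>
     (AE t in lebesgue_on {0..T}.
        (x has_vector_derivative (A t *v x t + B t *v u t)) (at t within {0..T}))"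

definition state ::
    "real \<Rightarrow> real^'n \<Rightarrow> (real \<Rightarrow> real^'n^'n) \<Rightarrow> (real \<Rightarrow> real^'m^'n) \<Rightarrow>
     (real \<Rightarrow> real^'m) \<Rightarrow> (real \<Rightarrow> real^'n)" where
  "state T x0 A B u = (THE x. x \<in> extensional {0..T} \<and> is_trajectory T x0 A B u x)"

definition payoff ::
    "real \<Rightarrow> real^'n \<Rightarrow> (real \<Rightarrow> real^'n^'n) \<Rightarrow> (real \<Rightarrow> real^'m^'n) \<Rightarrow>
     (real \<Rightarrow> real^'n \<Rightarrow> real^'m \<Rightarrow> real) \<Rightarrow> (real^'n \<Rightarrow> real) \<Rightarrow> (real \<Rightarrow> real^'m) \<Rightarrow> real" where
  "payoff T x0 A B f \<phi> u =
     (LINT t|lebesgue_on {0..T}. f t (state T x0 A B u t) (u t)) + \<phi> (state T x0 A B u T)"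

definition constraint ::
    "real \<Rightarrow> real^'n \<Rightarrow> (real \<Rightarrow> real^'n^'n) \<Rightarrow> (real \<Rightarrow> real^'m^'n) \<Rightarrow>
     (real \<Rightarrow> real^'n) \<Rightarrow> (real \<Rightarrow> real^'m) \<Rightarrow> (real \<Rightarrow> real) \<Rightarrow> (real \<Rightarrow> real^'m) \<Rightarrow> real" where
  "constraint T x0 A B a b c0 u =
     (LINT t|lebesgue_on {0..T}. a t \<bullet> state T x0 A B u t + b t \<bullet> u t + c0 t)"

definition bounded_measurable_on :: "real \<Rightarrow> (real \<Rightarrow> 'v::euclidean_space) \<Rightarrow> bool" where
  "bounded_measurable_on T g \<longleftrightarrow>
     g \<in> borel_measurable (lebesgue_on {0..T}) \<and> bounded (g ` {0..T})"

definition C1_fun :: "('a::euclidean_space \<Rightarrow> real) \<Rightarrow> bool" where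
  "C1_fun g \<longleftrightarrow>
     (\<exists>g'. (\<forall>z. (g has_derivative blinfun_apply (g' z)) (at z)) \<and> continuous_on UNIV g')"

definition upper_semicontinuous_map :: "'a topology \<Rightarrow> ('a \<Rightarrow> real) \<Rightarrow> bool" where
  "upper_semicontinuous_map X F \<longleftrightarrow> (\<forall>r. openin X {x \<in> topspace X. F x < r})"

text \<open>The function type carries no \<open>real_vector\<close> structure, so \<open>convex\<close> and \<open>concave_on\<close> are not
  available for sets of controls. As in \<open>concave_on\<close>, convexity of the domain is part of the
  notions below.\<close>

definition convex_comb :: "real \<Rightarrow> (real \<Rightarrow> 'v::real_vector) \<Rightarrow> (real \<Rightarrow> 'v) \<Rightarrow> real \<Rightarrow> 'v" where
  "convex_comb s u v = (\<lambda>t. (1 - s) *\<^sub>R u t + s *\<^sub>R v t)"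

definition convex_fun_set :: "(real \<Rightarrow> 'v::real_vector) set \<Rightarrow> bool" where
  "convex_fun_set K \<longleftrightarrow> (\<forall>u\<in>K. \<forall>v\<in>K. \<forall>s\<in>{0..1}. convex_comb s u v \<in> K)"

definition concave_functional_on ::
    "(real \<Rightarrow> 'v::real_vector) set \<Rightarrow> ((real \<Rightarrow> 'v) \<Rightarrow> real) \<Rightarrow> bool" where
  "concave_functional_on K F \<longleftrightarrow> convex_fun_set K \<and>
     (\<forall>u\<in>K. \<forall>v\<in>K. \<forall>s\<in>{0..1}. F (convex_comb s u v) \<ge> (1 - s) * F u + s * F v)"

definition affine_functional_on ::
    "(real \<Rightarrow> 'v::real_vector) set \<Rightarrow> ((real \<Rightarrow> 'v) \<Rightarrow> real) \<Rightarrow> bool" where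
  "affine_functional_on K F \<longleftrightarrow> convex_fun_set K \<and>
     (\<forall>u\<in>K. \<forall>v\<in>K. \<forall>s\<in>{0..1}. F (convex_comb s u v) = (1 - s) * F u + s * F v)"

text \<open>Affinity of an operator with values in \<open>C_space T\<close>; the restriction makes the pointwise
  combination \<open>undefined\<close> outside \<open>[0,T]\<close> again.\<close>

definition affine_operator_on ::
    "real \<Rightarrow> (real \<Rightarrow> 'v::real_vector) set \<Rightarrow> ((real \<Rightarrow> 'v) \<Rightarrow> (real \<Rightarrow> 'w::real_vector)) \<Rightarrow> bool" where
  "affine_operator_on T K G \<longleftrightarrow> convex_fun_set K \<and>
     (\<forall>u\<in>K. \<forall>v\<in>K. \<forall>s\<in>{0..1}.
        G (convex_comb s u v) = restrict (convex_comb s (G u) (G v)) {0..T})"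

end

theory Submission
  imports Defs
begin

text \<open>
  A Caratheodory trajectory is the same as a continuous solution of the Volterra equation
  \<open>x(t) = x\<^sub>0 + \<integral>\<^sub>0\<^sup>t (A x + B u)\<close>: one direction is the fundamental theorem of calculus for absolutely
  continuous functions, the other is Lebesgue's differentiation theorem. The Volterra equation has
  exactly one solution by Picard and Gronwall, so the state is affine in the control. The maps
  \<open>u \<mapsto> \<integral>\<^sub>0\<^sup>t B u\<close> are weak-* continuous for each \<open>t\<close> and, the controls being uniformly bounded,
  equicontinuous in \<open>t\<close>; hence they are weak-* continuous into the supremum norm, and Gronwall's
  inequality transfers this to the state. Concavity of the payoff then only needs the integrability
  of the running payoff, i.e. the measurability of a Caratheodory function along a control.
\<close>

section \<open>Lebesgue differentiation of indefinite integrals\<close>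

text \<open>The state is a definite description over functions with an a.e. derivative, whereas the
  weak-* topology sees only integrals; the Volterra equation removes the derivative, so that every
  later estimate concerns primitives. Controls in a weak-* neighbourhood need not be close in norm:
  such a neighbourhood constrains only finitely many pairings. Hence stability of the state has to
  be measured by the primitives of \<open>B u\<close> and \<open>B v\<close>, and their distance, a
  supremum over all times, has to be reduced to finitely many times. Equicontinuity does this by a
  finite net in [0,T], which yields a finite intersection of open sets. The argument works with
  neighbourhoods, not sequences, so metrizability of the topology is never at issue. The constraint
  splits into a pairing with \<open>u\<close>, continuous by the definition of the topology, and an
  integral functional of the state, continuous by the uniform estimate. Upper semicontinuity of the
  payoff is an assumption of the structured class.\<close>

lemma integral_real_diff:
  fixes f :: "real \<Rightarrow> 'b::banach"
  assumes f: "f integrable_on {a..b}" and st: "a \<le> s" "s \<le> t" "t \<le> b"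
  shows "integral {a..t} f - integral {a..s} f = integral {s..t} f"
proof -
  have "f integrable_on {a..t}"
    using integrable_on_subinterval[OF f, of a t] st by auto
  then show ?thesis
    using Henstock_Kurzweil_Integration.integral_combine[of a s t f] st
    by (metis add_diff_cancel_left')
qed

text \<open>Points where the derivative fails by more than \<open>e\<close> are covered by short intervals on which the
  Riemann sum is off by more than \<open>e\<close> times the length. Henstock's lemma bounds the total length of
  disjoint such intervals, and Vitali's lemma makes disjoint intervals suffice.\<close>

lemma has_vector_derivative_indefinite_integral_AE:
  fixes f :: "real \<Rightarrow> 'b::euclidean_space"
  assumes f: "f integrable_on {a..b}"
  shows "\<exists>N. negligible N \<and> (\<forall>x\<in>{a..b} - N.
    ((\<lambda>t. integral {a..t} f) has_vector_derivative f x) (at x within {a..b}))"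
proof -
  define F where "F \<equiv> \<lambda>t. integral {a..t} f"
  define Bad where "Bad \<equiv> \<lambda>e. {x\<in>{a..b}. \<forall>d>0. \<exists>y\<in>{a..b}. \<bar>y - x\<bar> < d \<and>
      norm (F y - F x - (y - x) *\<^sub>R f x) > e * \<bar>y - x\<bar>}"
  have neg: "negligible (Bad e)" if e: "e > 0" for e
    unfolding negligible_outer_le
  proof (intro allI impI)
    fix \<mu> :: real
    assume \<mu>: "\<mu> > 0"
    \<comment> \<open>The factor \<open>e\<close> converts the Riemann error into length; the 5 is
      the enlargement factor in Vitali's lemma.\<close>
    then have "\<mu> * e / 5 > 0"
      using e by simp
    then obtain \<gamma> where "gauge \<gamma>" and \<gamma>: "\<And>p. \<lbrakk>p tagged_partial_division_of (cbox a b); \<gamma> fine p\<rbrakk> \<Longrightarrow>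
             sum (\<lambda>(x,k). norm(measure lborel k *\<^sub>R f x - integral k f)) p < \<mu> * e / 5"
      using Henstock_lemma[of f a b "\<mu> * e / 5"] f unfolding box_real by blast
    have "\<exists>y\<in>{a..b}. cball ((x + y)/2) (\<bar>y - x\<bar>/2) \<subseteq> \<gamma> x \<and>
      norm (F y - F x - (y - x) *\<^sub>R f x) > e * \<bar>y - x\<bar>" if x: "x \<in> Bad e" for x
    proof -
      obtain d where d: "d > 0" "ball x d \<subseteq> \<gamma> x"
        using \<open>gauge \<gamma>\<close> unfolding gauge_def by (meson openE)
      then obtain y where y: "y \<in> {a..b}" "\<bar>y - x\<bar> < d" "norm (F y - F x - (y - x) *\<^sub>R f x) > e * \<bar>y - x\<bar>"
        using x unfolding Bad_def by blast
      have "cball ((x + y)/2) (\<bar>y - x\<bar>/2) \<subseteq> ball x d"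
      proof
        fix z assume "z \<in> cball ((x + y)/2) (\<bar>y - x\<bar>/2)"
        then have "\<bar>(x + y)/2 - z\<bar> \<le> \<bar>y - x\<bar>/2"
          by (simp add: dist_real_def)
        moreover have "\<bar>x - z\<bar> \<le> \<bar>(x + y)/2 - z\<bar> + \<bar>(y - x)/2\<bar>"
        proof -
          have "x - z = ((x + y)/2 - z) - (y - x)/2"
            by (simp add: field_simps)
          then show ?thesis
            by (metis abs_triangle_ineq4)
        qed
        ultimately have "\<bar>x - z\<bar> \<le> \<bar>y - x\<bar>"
          by simp
        then show "z \<in> ball x d"
          using y(2) by (simp add: dist_real_def)
      qed
      with d y show ?thesis by blast
    qed
    then obtain y where y: "\<And>x. x \<in> Bad e \<Longrightarrow> y x \<in> {a..b}"
        "\<And>x. x \<in> Bad e \<Longrightarrow> cball ((x + y x)/2) (\<bar>y x - x\<bar>/2) \<subseteq> \<gamma> x"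
        "\<And>x. x \<in> Bad e \<Longrightarrow> norm (F (y x) - F x - (y x - x) *\<^sub>R f x) > e * \<bar>y x - x\<bar>"
      by metis
    \<comment> \<open>The tag \<open>x\<close> is an endpoint of the interval between
      \<open>x\<close> and \<open>y x\<close>; recentred at the midpoint, that interval is a closed
      ball, the form in which Vitali's lemma applies.\<close>
    define c where "c \<equiv> \<lambda>x. (x + y x)/2"
    define r where "r \<equiv> \<lambda>x. \<bar>y x - x\<bar>/2"
    have xc: "x \<in> cball (c x) (r x)" for x
      by (auto simp: c_def r_def dist_real_def abs_if field_simps)
    have rpos: "r x > 0" if "x \<in> Bad e" for x
      using y(3)[OF that] by (auto simp: r_def)
    have rle: "r x \<le> b - a" if "x \<in> Bad e" for x
      using y(1)[OF that] that by (auto simp: r_def Bad_def)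
    have cov: "Bad e \<subseteq> (\<Union>x\<in>Bad e. cball (c x) (r x))"
      using xc by blast
    obtain C where C: "countable C" "C \<subseteq> Bad e"
      "pairwise (\<lambda>i j. disjnt (cball (c i) (r i)) (cball (c j) (r j))) C"
      "Bad e \<subseteq> (\<Union>i\<in>C. cball (c i) (5 * r i))"
      by (rule Vitali_covering_lemma_cballs[OF cov, of "b - a"]) (use rpos rle in blast)+
    have seg: "cball (c x) (r x) = {min x (y x)..max x (y x)}" for x
      by (auto simp: c_def r_def cball_eq_atLeastAtMost min_def max_def abs_if field_simps)
    \<comment> \<open>Henstock's lemma speaks of finite partial divisions, so the bound is proved
      for finite subfamilies; it then passes to the countable union.\<close>
    have bound: "measure lebesgue (\<Union>i\<in>D. cball (c i) (5 * r i)) \<le> \<mu>" if D: "finite D" "D \<subseteq> C" for D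
    proof -
      define p where "p = (\<lambda>x. (x, cball (c x) (r x))) ` D"
      have "p tagged_partial_division_of (cbox a b)"
        unfolding tagged_partial_division_of_def
      proof (intro conjI allI impI)
        show "finite p" using D by (simp add: p_def)
        fix x K assume "(x, K) \<in> p"
        then have xK: "x \<in> D" "K = cball (c x) (r x)" by (auto simp: p_def)
        show "x \<in> K" using xK xc by simp
        have "x \<in> Bad e" using xK D C by blast
        then have "x \<in> {a..b}" by (simp add: Bad_def)
        then show "K \<subseteq> cbox a b"
          using y(1)[OF \<open>x \<in> Bad e\<close>] by (auto simp: xK seg)
        show "\<exists>u v. K = cbox u v" unfolding xK seg by (metis box_real(2))
      next
        fix x1 K1 x2 K2
        assume "(x1, K1) \<in> p \<and> (x2, K2) \<in> p \<and> (x1, K1) \<noteq> (x2, K2)"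
        then have "x1 \<in> D" "x2 \<in> D" "x1 \<noteq> x2" "K1 = cball (c x1) (r x1)" "K2 = cball (c x2) (r x2)"
          by (auto simp: p_def)
        then have "disjnt K1 K2"
          using C(3) D by (meson pairwiseD subsetD)
        then show "interior K1 \<inter> interior K2 = {}"
          using interior_subset by (fastforce simp: disjnt_def)
      qed
      moreover have "\<gamma> fine p"
        using y(2) D C by (fastforce simp: fine_def p_def c_def r_def)
      ultimately have sum_less: "sum (\<lambda>(x,k). norm(measure lborel k *\<^sub>R f x - integral k f)) p < \<mu> * e / 5"
        by (rule \<gamma>)
      have sum_eq: "sum (\<lambda>(x,k). norm(measure lborel k *\<^sub>R f x - integral k f)) p =
          (\<Sum>x\<in>D. norm (measure lborel (cball (c x) (r x)) *\<^sub>R f x - integral (cball (c x) (r x)) f))"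
        unfolding p_def by (subst sum.reindex) (auto simp: inj_on_def)
      have "(\<Sum>x\<in>D. e * \<bar>y x - x\<bar>) \<le>
          (\<Sum>x\<in>D. norm (measure lborel (cball (c x) (r x)) *\<^sub>R f x - integral (cball (c x) (r x)) f))"
      proof (rule sum_mono)
        fix x assume "x \<in> D"
        then have x: "x \<in> Bad e" using D C by blast
        then have xab: "x \<in> {a..b}" "y x \<in> {a..b}" using y by (auto simp: Bad_def)
        have "norm (F (y x) - F x - (y x - x) *\<^sub>R f x) =
            norm (measure lborel (cball (c x) (r x)) *\<^sub>R f x - integral (cball (c x) (r x)) f)"
        proof (cases "x \<le> y x")
          case True
          then have "F (y x) - F x = integral {x..y x} f"
            unfolding F_def using integral_real_diff[OF f] xab by auto
          then show ?thesis
            using True by (simp add: seg norm_minus_commute)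
        next
          case False
          then have "F x - F (y x) = integral {y x..x} f"
            unfolding F_def using integral_real_diff[OF f] xab by auto
          then have "F (y x) - F x - (y x - x) *\<^sub>R f x = (x - y x) *\<^sub>R f x - integral {y x..x} f"
            by (simp add: algebra_simps)
          then show ?thesis
            using False by (simp add: seg min_def max_def)
        qed
        then show "e * \<bar>y x - x\<bar> \<le> norm (measure lborel (cball (c x) (r x)) *\<^sub>R f x - integral (cball (c x) (r x)) f)"
          using y(3)[OF x] by simp
      qed
      then have "e * (\<Sum>x\<in>D. \<bar>y x - x\<bar>) < \<mu> * e / 5"
        using sum_less unfolding sum_eq by (simp add: sum_distrib_left)
      then have "5 * (\<Sum>x\<in>D. \<bar>y x - x\<bar>) < \<mu>"
        using e by (simp add: field_simps)
      moreover have "measure lebesgue (cball (c x) (5 * r x)) = 5 * \<bar>y x - x\<bar>" for x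
        by (simp add: cball_eq_atLeastAtMost r_def)
      moreover have "measure lebesgue (\<Union>i\<in>D. cball (c i) (5 * r i))
          \<le> (\<Sum>i\<in>D. measure lebesgue (cball (c i) (5 * r i)))"
        by (rule measure_UNION_le) (use D in auto)
      ultimately show ?thesis
        by (simp add: sum_distrib_left)
    qed
    show "\<exists>T. Bad e \<subseteq> T \<and> T \<in> lmeasurable \<and> measure lebesgue T \<le> \<mu>"
    proof (intro exI conjI)
      show "(\<Union>i\<in>C. cball (c i) (5 * r i)) \<in> lmeasurable"
        by (rule fmeasurable_UN_bound[OF C(1) _ bound]) auto
      show "measure lebesgue (\<Union>i\<in>C. cball (c i) (5 * r i)) \<le> \<mu>"
        by (rule measure_UN_bound[OF C(1) _ bound]) auto
    qed (rule C)
  qed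
  have "negligible (\<Union>n. Bad (1 / real (Suc n)))"
    by (rule negligible_countable_Union) (auto intro!: neg)
  moreover have "(F has_vector_derivative f x) (at x within {a..b})"
    if x: "x \<in> {a..b}" "x \<notin> (\<Union>n. Bad (1 / real (Suc n)))" for x
    unfolding has_vector_derivative_def has_derivative_within_alt
  proof (intro conjI allI impI)
    show "bounded_linear (\<lambda>h. h *\<^sub>R f x)" by (rule bounded_linear_scaleR_left)
    fix e :: real assume "e > 0"
    then obtain n where n: "1 / real (Suc n) < e"
      using nat_approx_posE by blast
    have "x \<notin> Bad (1 / real (Suc n))" using x by blast
    then obtain d where d: "d > 0" "\<And>y. y \<in> {a..b} \<Longrightarrow> \<bar>y - x\<bar> < d \<Longrightarrow>
        norm (F y - F x - (y - x) *\<^sub>R f x) \<le> 1 / real (Suc n) * \<bar>y - x\<bar>"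
      using x(1) unfolding Bad_def mem_Collect_eq not_less[symmetric] by blast
    show "\<exists>d>0. \<forall>y\<in>{a..b}. norm (y - x) < d \<longrightarrow> norm (F y - F x - (y - x) *\<^sub>R f x) \<le> e * norm (y - x)"
    proof (intro exI[of _ d] conjI ballI impI)
      fix y assume y: "y \<in> {a..b}" "norm (y - x) < d"
      have "norm (F y - F x - (y - x) *\<^sub>R f x) \<le> 1 / real (Suc n) * \<bar>y - x\<bar>"
        using d y by simp
      also have "\<dots> \<le> e * norm (y - x)"
        using n \<open>e > 0\<close> by (intro mult_mono) auto
      finally show "norm (F y - F x - (y - x) *\<^sub>R f x) \<le> e * norm (y - x)" .
    qed (rule d)
  qed
  ultimately show ?thesis
    unfolding F_def by blast
qed

section \<open>Absolutely continuous functions\<close>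

text \<open>The gauge is given by differentiability off \<open>N\<close> and by an open superset of \<open>N\<close> of small measure
  on \<open>N\<close>, where absolute continuity controls the increments.\<close>

lemma has_integral_absolutely_continuous:
  fixes x :: "real \<Rightarrow> 'v::euclidean_space"
  assumes ab: "a \<le> b" and ac: "absolutely_continuous_on_ivl a b x"
    and N: "negligible N"
    and der: "\<And>t. t \<in> {a..b} - N \<Longrightarrow> (x has_vector_derivative f t) (at t within {a..b})"
  shows "(f has_integral x b - x a) {a..b}"
proof (cases "a = b")
  case True
  then show ?thesis by (simp add: has_integral_refl)
next
  case False
  with ab have ab: "a < b" by simp
  \<comment> \<open>With value 0 on \<open>N\<close>, an interval tagged in \<open>N\<close>
    contributes nothing but the increment of \<open>x\<close>. The change on a negligible set is
    undone by the spike rule at the end.\<close>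
  define g where "g = (\<lambda>t. if t \<in> N then 0 else f t)"
  have "(g has_integral x b - x a) {a..b}"
    unfolding has_integral_factor_content box_real[symmetric]
  proof safe
    fix e :: real
    assume "e > 0"
    \<comment> \<open>One half for the intervals tagged off \<open>N\<close>, the other for those
      tagged in \<open>N\<close>.\<close>
    define \<epsilon> where "\<epsilon> = e/2"
    have \<epsilon>: "\<epsilon> > 0" using \<open>e > 0\<close> by (simp add: \<epsilon>_def)
    have "\<epsilon> * (b - a) > 0" using \<epsilon> ab by simp
    then obtain \<delta> where "\<delta> > 0" and \<delta>: "\<forall>I. finite I \<and> (\<forall>(s,t)\<in>I. a \<le> s \<and> s \<le> t \<and> t \<le> b) \<and>
        disjoint_family_on (\<lambda>(s,t). {s<..<t}) I \<and> (\<Sum>(s,t)\<in>I. t - s) < \<delta> \<longrightarrow>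
        (\<Sum>(s,t)\<in>I. norm (x t - x s)) < \<epsilon> * (b - a)"
      using ac unfolding absolutely_continuous_on_ivl_def by blast
    have Nset: "N \<in> sets lebesgue" "N \<in> null_sets lebesgue"
      using N negligible_iff_null_sets negligible_imp_sets by auto
    obtain O' where O': "open O'" "N \<subseteq> O'" "O' - N \<in> lmeasurable" "emeasure lebesgue (O' - N) < ennreal \<delta>"
      using sets_lebesgue_outer_open[OF Nset(1) \<open>\<delta> > 0\<close>] by blast
    have "O' \<in> sets lebesgue" using O'(1) by simp
    then have "emeasure lebesgue O' < ennreal \<delta>"
      using O'(4) emeasure_Diff_null_set[OF Nset(2), of O'] by simp
    then have Om: "O' \<in> lmeasurable"
      using \<open>O' \<in> sets lebesgue\<close> by (auto simp: fmeasurable_def elim: order.strict_trans)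
    then have Om_less: "measure lebesgue O' < \<delta>"
      using \<open>emeasure lebesgue O' < ennreal \<delta>\<close> \<open>\<delta> > 0\<close>
      by (simp only: emeasure_eq_measure2 ennreal_less_iff measure_nonneg)
    have "\<forall>t. \<exists>d>0. t \<in> {a..b} - N \<longrightarrow>
         (\<forall>y\<in>{a..b}. norm (y-t) < d \<longrightarrow> norm (x y - x t - (y-t) *\<^sub>R f t) \<le> \<epsilon> * norm (y-t))"
      using der[unfolded has_vector_derivative_def has_derivative_within_alt] \<epsilon> by (meson zero_less_one)
    then obtain d where d: "\<And>t. 0 < d t"
                 "\<And>t y. \<lbrakk>t \<in> {a..b} - N; y \<in> {a..b}; norm (y-t) < d t\<rbrakk>
                        \<Longrightarrow> norm (x y - x t - (y-t) *\<^sub>R f t) \<le> \<epsilon> * norm (y-t)"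
      by metis
    define \<gamma> where "\<gamma> = (\<lambda>t. if t \<in> N then O' else ball t (d t))"
    have gauge: "gauge \<gamma>"
      using O' d by (auto simp: gauge_def \<gamma>_def)
    have *: "norm ((\<Sum>(t, K)\<in>p. measure lborel K *\<^sub>R g t) - (x b - x a)) \<le> e * measure lborel (cbox a b)"
      if ptag: "p tagged_division_of (cbox a b)" and fine: "\<gamma> fine p" for p
    proof -
      have fin: "finite p" using ptag by blast
      have props: "t \<in> K \<and> Inf K \<in> K \<and> Sup K \<in> K \<and> Inf K \<le> t \<and> t \<le> Sup K \<and>
          K = {Inf K..Sup K} \<and> K \<subseteq> {a..b} \<and> measure lborel K = Sup K - Inf K"
        if tK: "(t, K) \<in> p" for t K
      proof -
        obtain u v where K: "K = {u..v}"
          using tagged_division_ofD(4)[OF ptag tK] by (auto simp: box_real)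
        have t: "t \<in> K" "K \<subseteq> {a..b}"
          using tagged_division_ofD(2,3)[OF ptag tK] by (simp_all add: box_real)
        then have "u \<le> v" using K by simp
        then show ?thesis using t by (simp add: K)
      qed
      have ba: "b - a = (\<Sum>(t,K)\<in>p. Sup K - Inf K)" "x b - x a = (\<Sum>(t,K)\<in>p. x (Sup K) - x (Inf K))"
        using additive_tagged_division_1[of a b p "\<lambda>x. x"] additive_tagged_division_1[of a b p x]
          ab ptag unfolding box_real by simp_all
      define q where "q = {tK\<in>p. fst tK \<in> N}"
      have q: "q \<subseteq> p" "finite q" using fin by (auto simp: q_def)
      have good: "norm (\<Sum>(t,K)\<in>p - q. measure lborel K *\<^sub>R g t - (x (Sup K) - x (Inf K))) \<le> \<epsilon> * (b - a)"
      proof -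
        have "norm (\<Sum>(t,K)\<in>p - q. measure lborel K *\<^sub>R g t - (x (Sup K) - x (Inf K)))
            \<le> (\<Sum>(t,K)\<in>p - q. \<epsilon> * (Sup K - Inf K))"
        proof (rule sum_norm_le, safe)
          fix t K assume tK: "(t, K) \<in> p" "(t, K) \<notin> q"
          then have tN: "t \<notin> N" by (simp add: q_def)
          note P = props[OF tK(1)]
          have sub: "K \<subseteq> ball t (d t)" using fine tK(1) tN by (fastforce simp: fine_def \<gamma>_def)
          have tab: "t \<in> {a..b} - N" using P tN by blast
          have 1: "norm (x (Inf K) - x t - (Inf K - t) *\<^sub>R f t) \<le> \<epsilon> * norm (Inf K - t)"
            by (rule d(2)[OF tab]) (use P sub in \<open>auto simp: dist_real_def\<close>)
          have 2: "norm (x (Sup K) - x t - (Sup K - t) *\<^sub>R f t) \<le> \<epsilon> * norm (Sup K - t)"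
            by (rule d(2)[OF tab]) (use P sub in \<open>auto simp: dist_real_def\<close>)
          have mK: "measure lborel K = Sup K - Inf K" and gt: "g t = f t"
            using P tN by (simp_all add: g_def)
          have "norm (measure lborel K *\<^sub>R g t - (x (Sup K) - x (Inf K))) =
              norm ((x (Inf K) - x t - (Inf K - t) *\<^sub>R f t) - (x (Sup K) - x t - (Sup K - t) *\<^sub>R f t))"
            unfolding mK gt by (simp add: algebra_simps)
          also have "\<dots> \<le> \<epsilon> * norm (Inf K - t) + \<epsilon> * norm (Sup K - t)"
            using norm_triangle_ineq4 1 2 by (meson add_mono order_trans)
          also have "\<dots> = \<epsilon> * (Sup K - Inf K)"
            using P by (simp add: algebra_simps)
          finally show "norm (measure lborel K *\<^sub>R g t - (x (Sup K) - x (Inf K))) \<le> \<epsilon> * (Sup K - Inf K)" .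
        qed
        also have "\<dots> \<le> (\<Sum>(t,K)\<in>p. \<epsilon> * (Sup K - Inf K))"
          by (rule sum_mono2) (use fin props \<epsilon> in force)+
        also have "\<dots> = \<epsilon> * (b - a)"
          by (simp add: ba(1) sum_distrib_left split_def)
        finally show ?thesis .
      qed
      have bad: "norm (\<Sum>(t,K)\<in>q. measure lborel K *\<^sub>R g t - (x (Sup K) - x (Inf K))) \<le> \<epsilon> * (b - a)"
      proof -
        define I where "I = (\<lambda>(t,K). (Inf K, Sup K)) ` q"
        \<comment> \<open>Absolute continuity sums over a set of index pairs, so no pair may arise
          twice. Two tags on the same interval would force its interior to be empty, and a one-point
          interval has room for one tag only.\<close>
        have inj: "inj_on (\<lambda>(t,K). (Inf K, Sup K)) q"
        proof (rule inj_onI, clarify)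
          fix t K t' K' assume A: "(t, K) \<in> q" "(t', K') \<in> q" "Inf K = Inf K'" "Sup K = Sup K'"
          then have P: "(t, K) \<in> p" "(t', K') \<in> p" using q by auto
          then have KK: "K = K'" using props A(3,4) by metis
          have "t = t'"
          proof (rule ccontr)
            assume "t \<noteq> t'"
            then have "interior K \<inter> interior K' = {}"
              using ptag P unfolding tagged_division_of by blast
            then have "{Inf K<..<Sup K} = {}"
              using KK props[OF P(1)] interior_atLeastAtMost_real[of "Inf K" "Sup K"] by auto
            then have "Sup K \<le> Inf K" by simp
            then show False
              using props[OF P(1)] props[OF P(2)] KK \<open>t \<noteq> t'\<close> by fastforce
          qed
          with KK show "t = t' \<and> K = K'" by simp
        qed
        have Iq: "(\<Sum>(s,t)\<in>I. h s t) = (\<Sum>(t,K)\<in>q. h (Inf K) (Sup K))" for h :: "real \<Rightarrow> real \<Rightarrow> real"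
          unfolding I_def by (subst sum.reindex[OF inj]) (simp add: split_def o_def)
        have finI: "finite I" using q by (simp add: I_def)
        have Iab: "\<forall>(s,t)\<in>I. a \<le> s \<and> s \<le> t \<and> t \<le> b"
          using props q unfolding I_def by fastforce
        have disj: "disjoint_family_on (\<lambda>(s,t). {s<..<t}) I"
          unfolding disjoint_family_on_def
        proof (intro ballI impI)
          fix m n assume mn: "m \<in> I" "n \<in> I" "m \<noteq> n"
          then obtain t K t' K' where *: "(t,K) \<in> q" "(t',K') \<in> q" "m = (Inf K, Sup K)" "n = (Inf K', Sup K')"
            unfolding I_def by auto
          then have P: "(t, K) \<in> p" "(t', K') \<in> p" using q by auto
          have "(t,K) \<noteq> (t',K')" using mn * by auto
          then have "interior K \<inter> interior K' = {}"
            using ptag P unfolding tagged_division_of by blast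
          then show "(case m of (s, t) \<Rightarrow> {s<..<t}) \<inter> (case n of (s, t) \<Rightarrow> {s<..<t}) = {}"
            using props[OF P(1)] props[OF P(2)] * interior_atLeastAtMost_real by (metis case_prod_conv)
        qed
        \<comment> \<open>Disjointness turns the total length into the measure of a union inside
          \<open>O'\<close>, which is below the threshold \<open>\<delta>\<close> of absolute
          continuity.\<close>
        have "(\<Sum>(s,t)\<in>I. t - s) = (\<Sum>m\<in>I. measure lebesgue (case m of (s, t) \<Rightarrow> {s<..<t}))"
          using Iab by (intro sum.cong) auto
        also have "\<dots> = measure lebesgue (\<Union>m\<in>I. case m of (s, t) \<Rightarrow> {s<..<t})"
          by (rule measure_finite_Union[symmetric, OF finI _ disj])
            (use Iab in \<open>auto simp: emeasure_lborel_Ioo\<close>)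
        also have "\<dots> \<le> measure lebesgue O'"
        proof (rule measure_mono_fmeasurable[OF _ _ Om])
          show "(\<Union>m\<in>I. case m of (s, t) \<Rightarrow> {s<..<t}) \<subseteq> O'"
          proof
            fix z assume "z \<in> (\<Union>m\<in>I. case m of (s, t) \<Rightarrow> {s<..<t})"
            then obtain t K where *: "(t,K) \<in> q" "z \<in> {Inf K<..<Sup K}" unfolding I_def by auto
            then have "(t,K) \<in> p" "t \<in> N" by (auto simp: q_def)
            then have "K \<subseteq> O'" using fine by (fastforce simp: fine_def \<gamma>_def)
            moreover have "z \<in> K" using * props[OF \<open>(t,K) \<in> p\<close>] by (metis atLeastAtMost_iff greaterThanLessThan_iff less_imp_le)
            ultimately show "z \<in> O'" by blast
          qed
          show "(\<Union>m\<in>I. case m of (s, t) \<Rightarrow> {s<..<t}) \<in> sets lebesgue"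
            by (intro sets.finite_UN finI) auto
        qed
        also have "\<dots> < \<delta>" by (rule Om_less)
        finally have "(\<Sum>(s,t)\<in>I. norm (x t - x s)) < \<epsilon> * (b - a)"
          using \<delta> finI Iab disj by blast
        moreover have "norm (\<Sum>(t,K)\<in>q. measure lborel K *\<^sub>R g t - (x (Sup K) - x (Inf K))) \<le> (\<Sum>(t,K)\<in>q. norm (x (Sup K) - x (Inf K)))"
          by (rule sum_norm_le) (auto simp: q_def g_def norm_minus_commute)
        ultimately show ?thesis
          by (simp add: Iq)
      qed
      have "(\<Sum>(t, K)\<in>p. measure lborel K *\<^sub>R g t) - (x b - x a) = (\<Sum>(t,K)\<in>p. measure lborel K *\<^sub>R g t - (x (Sup K) - x (Inf K)))"
        by (simp add: ba(2) split_def sum_subtractf)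
      also have "\<dots> = (\<Sum>(t,K)\<in>p - q. measure lborel K *\<^sub>R g t - (x (Sup K) - x (Inf K))) +
          (\<Sum>(t,K)\<in>q. measure lborel K *\<^sub>R g t - (x (Sup K) - x (Inf K)))"
        by (rule sum.subset_diff[OF q(1) fin])
      also have "norm \<dots> \<le> \<epsilon> * (b - a) + \<epsilon> * (b - a)"
        using good bad norm_triangle_ineq by (meson add_mono order_trans)
      finally show ?thesis
        using ab by (simp add: \<epsilon>_def)
    qed
    show "\<exists>\<gamma>. gauge \<gamma> \<and> (\<forall>p. p tagged_division_of (cbox a b) \<and> \<gamma> fine p \<longrightarrow>
      norm ((\<Sum>(t, K)\<in>p. measure lborel K *\<^sub>R g t) - (x b - x a)) \<le> e * measure lborel (cbox a b))"
      by (intro exI[of _ \<gamma>] conjI gauge allI impI, elim conjE) (rule *)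
  qed
  then show ?thesis
    by (rule has_integral_spike[OF N, rotated]) (simp add: g_def)
qed

lemma absolutely_continuous_on_ivl_lipschitz:
  assumes "\<And>s t. a \<le> s \<Longrightarrow> s \<le> t \<Longrightarrow> t \<le> b \<Longrightarrow> norm (x t - x s) \<le> M * (t - s)"
  shows "absolutely_continuous_on_ivl a b x"
  unfolding absolutely_continuous_on_ivl_def
proof (intro allI impI)
  fix \<epsilon> :: real assume \<epsilon>: "\<epsilon> > 0"
  \<comment> \<open>\<open>M\<close> carries no sign assumption; \<open>\<bar>M\<bar> + 1\<close> is
    a Lipschitz constant by which one may divide.\<close>
  define \<delta> where "\<delta> = \<epsilon> / (\<bar>M\<bar> + 1)"
  show "\<exists>\<delta>>0. \<forall>I. finite I \<and> (\<forall>(s,t)\<in>I. a \<le> s \<and> s \<le> t \<and> t \<le> b) \<and>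
        disjoint_family_on (\<lambda>(s,t). {s<..<t}) I \<and> (\<Sum>(s,t)\<in>I. t - s) < \<delta>
        \<longrightarrow> (\<Sum>(s,t)\<in>I. norm (x t - x s)) < \<epsilon>"
  proof (intro exI[of _ \<delta>] conjI allI impI)
    show "\<delta> > 0" using \<epsilon> by (simp add: \<delta>_def)
    fix I
    assume I: "finite I \<and> (\<forall>(s,t)\<in>I. a \<le> s \<and> s \<le> t \<and> t \<le> b) \<and>
        disjoint_family_on (\<lambda>(s,t). {s<..<t}) I \<and> (\<Sum>(s,t)\<in>I. t - s) < \<delta>"
    have "(\<Sum>(s,t)\<in>I. norm (x t - x s)) \<le> (\<Sum>(s,t)\<in>I. (\<bar>M\<bar> + 1) * (t - s))"
    proof (rule sum_mono, clarify)
      fix s t assume "(s, t) \<in> I"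
      then have st: "a \<le> s" "s \<le> t" "t \<le> b" using I by auto
      have "norm (x t - x s) \<le> M * (t - s)" by (rule assms[OF st])
      also have "\<dots> \<le> (\<bar>M\<bar> + 1) * (t - s)"
        using st by (intro mult_right_mono) auto
      finally show "norm (x t - x s) \<le> (\<bar>M\<bar> + 1) * (t - s)" .
    qed
    also have "\<dots> = (\<bar>M\<bar> + 1) * (\<Sum>(s,t)\<in>I. t - s)"
      by (simp add: sum_distrib_left split_def)
    also have "\<dots> < (\<bar>M\<bar> + 1) * \<delta>"
      using I by (intro mult_strict_left_mono) auto
    also have "\<dots> = \<epsilon>" by (simp add: \<delta>_def)
    finally show "(\<Sum>(s,t)\<in>I. norm (x t - x s)) < \<epsilon>" .
  qed
qed

lemma absolutely_continuous_on_ivl_subinterval: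
  assumes "absolutely_continuous_on_ivl a b x" "a \<le> c" "d \<le> b"
  shows "absolutely_continuous_on_ivl c d x"
  unfolding absolutely_continuous_on_ivl_def
proof (intro allI impI)
  fix \<epsilon> :: real assume "\<epsilon> > 0"
  then obtain \<delta> where "\<delta> > 0" and \<delta>: "\<forall>I. finite I \<and> (\<forall>(s,t)\<in>I. a \<le> s \<and> s \<le> t \<and> t \<le> b) \<and>
        disjoint_family_on (\<lambda>(s,t). {s<..<t}) I \<and> (\<Sum>(s,t)\<in>I. t - s) < \<delta>
        \<longrightarrow> (\<Sum>(s,t)\<in>I. norm (x t - x s)) < \<epsilon>"
    using assms(1) unfolding absolutely_continuous_on_ivl_def by blast
  show "\<exists>\<delta>>0. \<forall>I. finite I \<and> (\<forall>(s,t)\<in>I. c \<le> s \<and> s \<le> t \<and> t \<le> d) \<and>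
        disjoint_family_on (\<lambda>(s,t). {s<..<t}) I \<and> (\<Sum>(s,t)\<in>I. t - s) < \<delta>
        \<longrightarrow> (\<Sum>(s,t)\<in>I. norm (x t - x s)) < \<epsilon>"
  proof (intro exI[of _ \<delta>] conjI allI impI \<open>\<delta> > 0\<close>, elim conjE)
    fix I
    assume I: "finite I" "\<forall>(s,t)\<in>I. c \<le> s \<and> s \<le> t \<and> t \<le> d"
        "disjoint_family_on (\<lambda>(s,t). {s<..<t}) I" "(\<Sum>(s,t)\<in>I. t - s) < \<delta>"
    have "\<forall>(s,t)\<in>I. a \<le> s \<and> s \<le> t \<and> t \<le> b"
      using I(2) assms(2,3) by fastforce
    with I \<delta> show "(\<Sum>(s,t)\<in>I. norm (x t - x s)) < \<epsilon>" by blast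
  qed
qed

lemma absolutely_continuous_on_ivl_imp_continuous_on:
  assumes "absolutely_continuous_on_ivl a b x"
  shows "continuous_on {a..b} x"
  unfolding continuous_on_iff
proof (intro ballI allI impI)
  fix s \<epsilon> :: real assume s: "s \<in> {a..b}" and "\<epsilon> > 0"
  then obtain \<delta> where "\<delta> > 0" and \<delta>: "\<forall>I. finite I \<and> (\<forall>(s,t)\<in>I. a \<le> s \<and> s \<le> t \<and> t \<le> b) \<and>
        disjoint_family_on (\<lambda>(s,t). {s<..<t}) I \<and> (\<Sum>(s,t)\<in>I. t - s) < \<delta>
        \<longrightarrow> (\<Sum>(s,t)\<in>I. norm (x t - x s)) < \<epsilon>"
    using assms unfolding absolutely_continuous_on_ivl_def by blast
  have *: "norm (x r - x q) < \<epsilon>" if "a \<le> q" "q \<le> r" "r \<le> b" "r - q < \<delta>" for q r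
    using \<delta>[rule_format, of "{(q, r)}"] that by (simp add: disjoint_family_on_def)
  show "\<exists>d>0. \<forall>t\<in>{a..b}. dist t s < d \<longrightarrow> dist (x t) (x s) < \<epsilon>"
  proof (intro exI[of _ \<delta>] conjI ballI impI \<open>\<delta> > 0\<close>)
    fix t assume t: "t \<in> {a..b}" "dist t s < \<delta>"
    show "dist (x t) (x s) < \<epsilon>"
    proof (cases "s \<le> t")
      case True
      then show ?thesis using *[of s t] t s by (simp add: dist_norm)
    next
      case False
      then show ?thesis using *[of t s] t s by (simp add: dist_norm norm_minus_commute)
    qed
  qed
qed

section \<open>Volterra integral equations\<close>

text \<open>For the primitive \<open>q\<close> of \<open>p\<close> the hypothesis is a differential
  inequality. With the integrating factor, \<open>r = (D + L * q) * exp (- (L * t))\<close> has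
  derivative \<open>L * (p - D - L * q) * exp (- (L * t))\<close>, which is at most 0, and
  \<open>r\<close> starts at \<open>D\<close>.\<close>

lemma gronwall:
  fixes p :: "real \<Rightarrow> real"
  assumes cont: "continuous_on {0..T} p" and L: "L \<ge> 0"
    and le: "\<And>t. t \<in> {0..T} \<Longrightarrow> p t \<le> D + L * integral {0..t} p"
    and t: "t \<in> {0..T}"
  shows "p t \<le> D * exp (L * t)"
proof -
  define q where "q = (\<lambda>t. integral {0..t} p)"
  define r where "r = (\<lambda>t. (D + L * q t) * exp (- (L * t)))"
  have dq: "(q has_real_derivative p x) (at x within {0..T})" if "x \<in> {0..T}" for x
    unfolding q_def using integral_has_vector_derivative[OF cont that]
    by (simp add: has_real_derivative_iff_has_vector_derivative)
  then have contq: "continuous_on {0..T} q"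
    by (rule DERIV_continuous_on)
  have "r 0 \<ge> r t"
  proof (rule DERIV_nonpos_imp_decreasing_open[of 0 t r])
    show "0 \<le> t" using t by simp
    show "continuous_on {0..t} r"
      unfolding r_def by (intro continuous_intros continuous_on_subset[OF contq]) (use t in auto)
    fix x assume x: "0 < x" "x < t"
    then have xT: "x \<in> {0..T}" "x \<in> {0<..<T}" using t by auto
    have "(q has_real_derivative p x) (at x)"
      using dq[OF xT(1)] xT by (simp add: at_within_Icc_at)
    then have "(r has_real_derivative (L * p x - L * (D + L * q x)) * exp (- (L * x))) (at x)"
      unfolding r_def by (auto intro!: derivative_eq_intros simp: algebra_simps)
    moreover have "p x \<le> D + L * q x"
      using le[OF xT(1)] by (simp add: q_def)
    then have "L * p x - L * (D + L * q x) \<le> 0"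
      using L by (simp add: mult_left_mono)
    ultimately show "\<exists>y. DERIV r x :> y \<and> y \<le> 0"
      by (metis exp_ge_zero mult_nonpos_nonneg)
  qed
  then have "D + L * q t \<le> D * exp (L * t)"
    by (simp add: r_def q_def exp_minus field_simps)
  moreover have "p t \<le> D + L * q t"
    using le[OF t] by (simp add: q_def)
  ultimately show ?thesis by simp
qed

lemma integral_exp_Icc:
  fixes K :: real
  assumes "K \<noteq> 0" "0 \<le> t"
  shows "((\<lambda>s. exp (K * s)) has_integral (exp (K * t) - 1) / K) {0..t}"
proof -
  have "((\<lambda>s. exp (K * s)) has_integral exp (K * t) / K - exp (K * 0) / K) {0..t}"
    using assms by (intro fundamental_theorem_of_calculus)
      (auto intro!: derivative_eq_intros simp: has_real_derivative_iff_has_vector_derivative[symmetric])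
  then show ?thesis
    by (simp add: diff_divide_distrib)
qed

text \<open>Picard's iteration contracts for the weighted norm \<open>sup\<^sub>t e\<^bsup>-2Mt\<^esup> |x(t)|\<close> with \<open>M > |L|\<close>.
  The weight is moved into the operator, which acts on \<open>z(t) = e\<^bsup>-2Mt\<^esup> x(t)\<close>, extended constantly
  outside \<open>[0,T]\<close>.\<close>

lemma integral_equation_exists:
  fixes G :: "real \<Rightarrow> 'v::euclidean_space \<Rightarrow> 'v"
  assumes T: "T \<ge> 0"
    and int: "\<And>z. continuous_on {0..T} z \<Longrightarrow> (\<lambda>t. G t (z t)) integrable_on {0..T}"
    and lip: "\<And>t x y. t \<in> {0..T} \<Longrightarrow> norm (G t x - G t y) \<le> L * norm (x - y)"
  shows "\<exists>x. continuous_on {0..T} x \<and> (\<forall>t\<in>{0..T}. x t = x0 + integral {0..t} (\<lambda>s. G s (x s)))"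
proof -
  define M where "M = \<bar>L\<bar> + 1"
  \<comment> \<open>The weight \<open>exp (K * s)\<close> has integral at most
    \<open>exp (K * t) / K\<close> over [0,t], so the contraction factor is \<open>M / K\<close>,
    that is 1/2.\<close>
  define K where "K = 2 * M"
  have M: "M > 0" "K > 0" by (auto simp: M_def K_def)
  have lip: "norm (G t x - G t y) \<le> M * norm (x - y)" if "t \<in> {0..T}" for t x y
    using lip[OF that, of x y] mult_right_mono[of L M "norm (x - y)"]
    by (auto simp: M_def elim: order_trans)
  \<comment> \<open>A retraction onto [0,T]: the complete space used for the fixed point consists of
    bounded continuous functions on all of \<open>real\<close>.\<close>
  define c where "c = (\<lambda>t. max 0 (min T t))"
  have c: "continuous_on UNIV c" "\<And>t. c t \<in> {0..T}" "\<And>t. t \<in> {0..T} \<Longrightarrow> c t = t"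
    using T by (auto simp: c_def intro!: continuous_intros)
  define g where "g = (\<lambda>z :: real \<Rightarrow>\<^sub>C 'v. \<lambda>s. G s (exp (K * s) *\<^sub>R apply_bcontfun z s))"
  define \<Psi> where "\<Psi> = (\<lambda>z :: real \<Rightarrow>\<^sub>C 'v. \<lambda>t. exp (- (K * t)) *\<^sub>R (x0 + integral {0..t} (g z)))"
  have gint: "g z integrable_on {0..T}" for z
    unfolding g_def
    by (rule int) (intro continuous_intros continuous_on_apply_bcontfun)
  have gint': "g z integrable_on {0..t}" if "t \<in> {0..T}" for z t
    using integrable_on_subinterval[OF gint, of 0 t] that by auto
  have \<Psi>c: "continuous_on {0..T} (\<Psi> z)" for z
    unfolding \<Psi>_def by (intro continuous_intros indefinite_integral_continuous_1 gint)
  have "(\<lambda>t. \<Psi> z (c t)) \<in> bcontfun" for z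
    unfolding bcontfun_def mem_Collect_eq
  proof
    show "continuous_on UNIV (\<lambda>t. \<Psi> z (c t))"
      by (rule continuous_on_compose2[OF \<Psi>c c(1)]) (use c in auto)
    have "bounded (\<Psi> z ` {0..T})"
      by (intro compact_imp_bounded compact_continuous_image \<Psi>c compact_Icc)
    then show "bounded (range (\<lambda>t. \<Psi> z (c t)))"
      by (rule bounded_subset) (use c in auto)
  qed
  then have Bc: "apply_bcontfun (Bcontfun (\<lambda>t. \<Psi> z (c t))) t = \<Psi> z (c t)" for z t
    by (simp add: Bcontfun_inverse)
  define \<Phi> where "\<Phi> = (\<lambda>z. Bcontfun (\<lambda>t. \<Psi> z (c t)))"
  have app: "apply_bcontfun (\<Phi> z) t = \<Psi> z (c t)" for z t
    unfolding \<Phi>_def by (rule Bc)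
  have "dist (\<Phi> z) (\<Phi> w) \<le> 1/2 * dist z w" for z w
  proof (rule dist_bound)
    fix t0
    define t where "t = c t0"
    have t: "t \<in> {0..T}" using c by (simp add: t_def)
    have "norm (integral {0..t} (g z) - integral {0..t} (g w)) = norm (integral {0..t} (\<lambda>s. g z s - g w s))"
      by (simp only: Henstock_Kurzweil_Integration.integral_diff[OF gint'[OF t] gint'[OF t]])
    also have "\<dots> \<le> integral {0..t} (\<lambda>s. M * dist z w * exp (K * s))"
    proof (rule integral_norm_bound_integral)
      show "(\<lambda>s. g z s - g w s) integrable_on {0..t}"
        by (intro integrable_diff gint' t)
      show "(\<lambda>s. M * dist z w * exp (K * s)) integrable_on {0..t}"
        by (intro integrable_continuous_interval continuous_intros)
      fix s assume "s \<in> {0..t}"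
      then have s: "s \<in> {0..T}" using t by auto
      have "norm (g z s - g w s) \<le> M * norm (exp (K * s) *\<^sub>R apply_bcontfun z s - exp (K * s) *\<^sub>R apply_bcontfun w s)"
        unfolding g_def by (rule lip[OF s])
      also have "\<dots> = M * (exp (K * s) * dist (apply_bcontfun z s) (apply_bcontfun w s))"
        by (simp add: scaleR_diff_right[symmetric] dist_norm)
      also have "\<dots> \<le> M * (exp (K * s) * dist z w)"
        using M by (intro mult_left_mono dist_bounded) auto
      finally show "norm (g z s - g w s) \<le> M * dist z w * exp (K * s)"
        by (simp add: mult_ac)
    qed
    also have "\<dots> = M * dist z w * ((exp (K * t) - 1) / K)"
      using integral_exp_Icc[of K t] M t by (simp add: integral_unique)
    also have "\<dots> \<le> M * dist z w * (exp (K * t) / K)"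
      using M by (intro mult_left_mono divide_right_mono) auto
    also have "\<dots> = 1/2 * dist z w * exp (K * t)"
      using M by (simp add: K_def)
    finally have "exp (- (K * t)) * norm (integral {0..t} (g z) - integral {0..t} (g w)) \<le> 1/2 * dist z w"
      by (simp add: exp_minus field_simps)
    moreover have "dist (\<Phi> z t0) (\<Phi> w t0) = exp (- (K * t)) * norm (integral {0..t} (g z) - integral {0..t} (g w))"
      unfolding app t_def[symmetric] by (simp add: \<Psi>_def dist_norm scaleR_diff_right[symmetric])
    ultimately show "dist (\<Phi> z t0) (\<Phi> w t0) \<le> 1/2 * dist z w" by simp
  qed
  then have "\<exists>!z. \<Phi> z = z"
    by (intro banach_fix_type[of "1/2"]) auto
  then obtain z where z: "\<Phi> z = z" by blast
  define x where "x = (\<lambda>t. exp (K * t) *\<^sub>R apply_bcontfun z t)"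
  have "continuous_on {0..T} x"
    unfolding x_def
    by (intro continuous_intros continuous_on_apply_bcontfun)
  moreover have "x t = x0 + integral {0..t} (\<lambda>s. G s (x s))" if "t \<in> {0..T}" for t
  proof -
    have "apply_bcontfun z t = \<Psi> z t"
      using app[of z t] z c(3)[OF that] by simp
    then show ?thesis
      by (simp add: x_def \<Psi>_def g_def exp_minus)
  qed
  ultimately show ?thesis by blast
qed

section \<open>Essentially bounded functions\<close>

text \<open>The bridge between the a.e. statements of the definitions and the negligible exceptional
  sets that gauge integration works with.\<close>

lemma AE_lebesgue_on_Icc_iff:
  fixes a b :: real
  shows "(AE t in lebesgue_on {a..b}. P t) \<longleftrightarrow> (\<exists>N. negligible N \<and> (\<forall>t\<in>{a..b} - N. P t))"
proof -
  have "(AE t in lebesgue_on {a..b}. P t) \<longleftrightarrow> (AE t in lebesgue. t \<in> {a..b} \<longrightarrow> P t)"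
    by (rule AE_restrict_space_iff) simp
  also have "\<dots> \<longleftrightarrow> (\<exists>N. negligible N \<and> (\<forall>t\<in>{a..b} - N. P t))"
  proof
    assume "AE t in lebesgue. t \<in> {a..b} \<longrightarrow> P t"
    then obtain N where "N \<in> null_sets lebesgue" "{t. \<not> (t \<in> {a..b} \<longrightarrow> P t)} \<subseteq> N"
      unfolding eventually_ae_filter by auto
    then show "\<exists>N. negligible N \<and> (\<forall>t\<in>{a..b} - N. P t)"
      by (intro exI[of _ N]) (auto simp: negligible_iff_null_sets)
  next
    assume "\<exists>N. negligible N \<and> (\<forall>t\<in>{a..b} - N. P t)"
    then show "AE t in lebesgue. t \<in> {a..b} \<longrightarrow> P t"
    proof (elim exE conjE)
      fix N assume "negligible N" "\<forall>t\<in>{a..b} - N. P t"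
      then show ?thesis
        by (intro AE_I'[of N]) (auto simp: negligible_iff_null_sets)
    qed
  qed
  finally show ?thesis .
qed

lemma AE_lebesgue_on_self: "AE t in lebesgue_on {a..b::real}. t \<in> {a..b}"
  using AE_space[of "lebesgue_on {a..b}"] by simp

lemma LinfI:
  assumes "u \<in> borel_measurable (lebesgue_on {0..T})"
    and "AE t in lebesgue_on {0..T}. norm (u t) \<le> M"
  shows "u \<in> Linf T"
  using assms unfolding Linf_def by blast

lemma Linf_measurable: "u \<in> Linf T \<Longrightarrow> u \<in> borel_measurable (lebesgue_on {0..T})"
  by (simp add: Linf_def)

lemma Linf_bound:
  assumes "u \<in> Linf T"
  obtains M where "M \<ge> 0" "AE t in lebesgue_on {0..T}. norm (u t) \<le> M"
proof -
  obtain M where M: "AE t in lebesgue_on {0..T}. norm (u t) \<le> M"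
    using assms by (auto simp: Linf_def)
  then have "AE t in lebesgue_on {0..T}. norm (u t) \<le> max 0 M"
    by eventually_elim simp
  with that[of "max 0 M"] show ?thesis by simp
qed

lemma integrable_Linf:
  assumes u: "u \<in> Linf T"
  shows "integrable (lebesgue_on {0..T}) u"
proof -
  obtain M where "AE t in lebesgue_on {0..T}. norm (u t) \<le> M"
    using Linf_bound[OF u] .
  moreover have "finite_measure (lebesgue_on {0..T})"
    by (rule finite_measure_lebesgue_on) simp
  ultimately show ?thesis
    by (intro finite_measure.integrable_const_bound Linf_measurable[OF u])
qed

lemma integrable_on_Linf: "u \<in> Linf T \<Longrightarrow> u integrable_on {0..T}"
  by (rule integrable_on_lebesgue_on[OF integrable_Linf]) simp_all

lemma integrable_on_Linf_subinterval:
  assumes "u \<in> Linf T" "0 \<le> s" "t \<le> T"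
  shows "u integrable_on {s..t}"
  using integrable_on_subinterval[OF integrable_on_Linf[OF assms(1)], of s t] assms by auto

lemma continuous_on_imp_Linf:
  fixes x :: "real \<Rightarrow> 'v::euclidean_space"
  assumes x: "continuous_on {0..T} x"
  shows "x \<in> Linf T"
proof -
  have "bounded (x ` {0..T})"
    by (intro compact_imp_bounded compact_continuous_image x compact_Icc)
  then obtain M where "\<forall>y\<in>x ` {0..T}. norm y \<le> M"
    unfolding bounded_iff ..
  then have M: "norm (x t) \<le> M" if "t \<in> {0..T}" for t
    using that by blast
  show ?thesis
  proof (rule LinfI)
    show "x \<in> borel_measurable (lebesgue_on {0..T})"
      by (rule continuous_imp_measurable_on_sets_lebesgue[OF x]) simp
    show "AE t in lebesgue_on {0..T}. norm (x t) \<le> M"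
      using AE_lebesgue_on_self by eventually_elim (rule M)
  qed
qed

lemma bounded_measurable_on_imp_Linf:
  assumes "bounded_measurable_on T g"
  shows "g \<in> Linf T"
proof -
  obtain M where "\<forall>y\<in>g ` {0..T}. norm y \<le> M"
    using assms unfolding bounded_iff bounded_measurable_on_def by (elim conjE exE)
  then have M: "norm (g t) \<le> M" if "t \<in> {0..T}" for t
    using that by blast
  have "AE t in lebesgue_on {0..T}. norm (g t) \<le> M"
    using AE_lebesgue_on_self by eventually_elim (rule M)
  then show ?thesis
    using assms by (auto simp: bounded_measurable_on_def intro: LinfI)
qed

lemma Linf_add:
  assumes f: "f \<in> Linf T" and g: "g \<in> Linf T"
  shows "(\<lambda>t. f t + g t) \<in> Linf T"
proof -
  obtain M where M: "AE t in lebesgue_on {0..T}. norm (f t) \<le> M"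
    using Linf_bound[OF f] .
  obtain K where K: "AE t in lebesgue_on {0..T}. norm (g t) \<le> K"
    using Linf_bound[OF g] .
  show ?thesis
  proof (rule LinfI)
    show "(\<lambda>t. f t + g t) \<in> borel_measurable (lebesgue_on {0..T})"
      using f g by (intro borel_measurable_add Linf_measurable)
    show "AE t in lebesgue_on {0..T}. norm (f t + g t) \<le> M + K"
      using M K by eventually_elim (rule norm_triangle_mono)
  qed
qed

text \<open>Treats all products of the development at once: \<open>*v\<close>, \<open>v*\<close>,
  the inner product and scalar multiplication. Measurability comes from joint continuity, the bound
  from boundedness of the bilinear map.\<close>

lemma Linf_bilinear:
  fixes f :: "real \<Rightarrow> 'a::euclidean_space" and g :: "real \<Rightarrow> 'b::euclidean_space"
    and h :: "'a \<Rightarrow> 'b \<Rightarrow> 'c::euclidean_space"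
  assumes h: "bounded_bilinear h" and f: "f \<in> Linf T" and g: "g \<in> Linf T"
  shows "(\<lambda>t. h (f t) (g t)) \<in> Linf T"
proof -
  obtain M where M: "M \<ge> 0" "AE t in lebesgue_on {0..T}. norm (f t) \<le> M"
    using Linf_bound[OF f] .
  obtain K where K: "AE t in lebesgue_on {0..T}. norm (g t) \<le> K"
    using Linf_bound[OF g] .
  obtain C where C: "C \<ge> 0" "\<And>a b. norm (h a b) \<le> norm a * norm b * C"
    using bounded_bilinear.nonneg_bounded[OF h] by blast
  show ?thesis
  proof (rule LinfI)
    show "(\<lambda>t. h (f t) (g t)) \<in> borel_measurable (lebesgue_on {0..T})"
      by (rule borel_measurable_continuous_Pair[OF Linf_measurable[OF f] Linf_measurable[OF g]])
        (intro bounded_bilinear.continuous_on[OF h] continuous_intros)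
    show "AE t in lebesgue_on {0..T}. norm (h (f t) (g t)) \<le> M * K * C"
      using M(2) K
    proof eventually_elim
      case (elim t)
      have "norm (h (f t) (g t)) \<le> norm (f t) * norm (g t) * C" by (rule C)
      also have "\<dots> \<le> M * K * C"
        using elim M(1) C by (intro mult_right_mono mult_mono) auto
      finally show ?case .
    qed
  qed
qed

lemma Linf_scaleR:
  assumes "f \<in> Linf T"
  shows "(\<lambda>t. c *\<^sub>R f t) \<in> Linf T"
  by (rule Linf_bilinear[OF bounded_bilinear_scaleR continuous_on_imp_Linf assms]) (rule continuous_on_const)

lemma Linf_convex_comb:
  "u \<in> Linf T \<Longrightarrow> v \<in> Linf T \<Longrightarrow> convex_comb s u v \<in> Linf T"
  unfolding convex_comb_def by (intro Linf_add Linf_scaleR)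

lemma norm_integral_AE_le:
  fixes f :: "real \<Rightarrow> 'v::euclidean_space"
  assumes f: "f integrable_on {s..t}" and M: "0 \<le> M" and "0 \<le> s" "s \<le> t" "t \<le> T"
    and ae: "AE t in lebesgue_on {0..T}. norm (f t) \<le> M"
  shows "norm (integral {s..t} f) \<le> M * (t - s)"
proof -
  obtain N where N: "negligible N" "\<And>r. r \<in> {0..T} - N \<Longrightarrow> norm (f r) \<le> M"
    using ae unfolding AE_lebesgue_on_Icc_iff by blast
  \<comment> \<open>The rule \<open>has_integral_bound\<close> asks for the bound at every point, so
    \<open>f\<close> is erased on the exceptional set.\<close>
  define g where "g = (\<lambda>r. if r \<in> N then 0 else f r)"
  have "(g has_integral integral {s..t} f) (cbox s t)"
    unfolding box_real
    by (rule has_integral_spike[OF N(1) _ integrable_integral[OF f]]) (simp add: g_def)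
  then have "norm (integral {s..t} f) \<le> M * measure lborel (cbox s t)"
    by (rule has_integral_bound[OF M]) (use N assms in \<open>auto simp: g_def\<close>)
  then show ?thesis using assms by simp
qed

section \<open>The state equation\<close>

lemma bounded_bilinear_matrix_vector_mult:
  "bounded_bilinear ((*v) :: real^'n^'m \<Rightarrow> real^'n \<Rightarrow> real^'m)"
  unfolding bilinear_conv_bounded_bilinear[symmetric] bilinear_def
  by (auto intro!: linearI simp: matrix_vector_mult_add_rdistrib matrix_vector_right_distrib
      scaleR_matrix_vector_assoc matrix_vector_mult_scaleR)

locale linear_system =
  fixes T :: real
    and x0 :: "real^'n"
    and A :: "real \<Rightarrow> real^'n^'n"
    and B :: "real \<Rightarrow> real^'m^'n"
  assumes T_pos: "T > 0"
    and A: "bounded_measurable_on T A"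
    and B: "bounded_measurable_on T B"
begin

text \<open>The Volterra form of the state equation. Unlike in \<open>state\<close>, values outside
  [0,T] are left free, so that solutions can be combined pointwise and restricted without side
  conditions.\<close>

definition solution :: "(real \<Rightarrow> real^'m) \<Rightarrow> (real \<Rightarrow> real^'n) \<Rightarrow> bool" where
  "solution u x \<longleftrightarrow> continuous_on {0..T} x \<and>
     (\<forall>t\<in>{0..T}. x t = x0 + integral {0..t} (\<lambda>s. A s *v x s + B s *v u s))"

lemma Linf_A: "continuous_on {0..T} x \<Longrightarrow> (\<lambda>s. A s *v x s) \<in> Linf T"
  by (rule Linf_bilinear[OF bounded_bilinear_matrix_vector_mult bounded_measurable_on_imp_Linf[OF A]
        continuous_on_imp_Linf])

lemma Linf_B: "u \<in> Linf T \<Longrightarrow> (\<lambda>s. B s *v u s) \<in> Linf T"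
  by (rule Linf_bilinear[OF bounded_bilinear_matrix_vector_mult bounded_measurable_on_imp_Linf[OF B]])

lemma Linf_rhs:
  "continuous_on {0..T} x \<Longrightarrow> u \<in> Linf T \<Longrightarrow> (\<lambda>s. A s *v x s + B s *v u s) \<in> Linf T"
  by (intro Linf_add Linf_A Linf_B)

lemma A_bound:
  obtains L where "L \<ge> 0" "\<And>t z. t \<in> {0..T} \<Longrightarrow> norm (A t *v z) \<le> L * norm z"
proof -
  obtain M where M: "\<forall>y\<in>A ` {0..T}. norm y \<le> M"
    using A unfolding bounded_iff bounded_measurable_on_def by (elim conjE exE)
  obtain C where C: "C \<ge> 0" "\<And>(a :: real^'n^'n) (b :: real^'n). norm (a *v b) \<le> norm a * norm b * C"
    using bounded_bilinear.nonneg_bounded[OF bounded_bilinear_matrix_vector_mult] by blast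
  have "norm (A t *v z) \<le> \<bar>M\<bar> * C * norm z" if "t \<in> {0..T}" for t z
  proof -
    have "norm (A t *v z) \<le> norm (A t) * (norm z * C)"
      using C(2)[of "A t" z] by (simp add: mult_ac)
    also have "norm (A t) \<le> \<bar>M\<bar>"
      using M that by (meson abs_ge_self imageI order_trans)
    then have "norm (A t) * (norm z * C) \<le> \<bar>M\<bar> * (norm z * C)"
      using C(1) by (intro mult_right_mono) auto
    finally show ?thesis by (simp add: mult_ac)
  qed
  then show ?thesis
    using that[of "\<bar>M\<bar> * C"] C(1) by simp
qed

section \<open>Existence, stability and uniqueness for the Volterra equation\<close>

lemma solution_exists:
  assumes u: "u \<in> Linf T"
  shows "\<exists>x. solution u x"
proof -
  obtain L where L: "L \<ge> 0" "\<And>t z. t \<in> {0..T} \<Longrightarrow> norm (A t *v z) \<le> L * norm z"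
    using A_bound by blast
  have "\<exists>x. continuous_on {0..T} x \<and>
      (\<forall>t\<in>{0..T}. x t = x0 + integral {0..t} (\<lambda>s. (\<lambda>s z. A s *v z + B s *v u s) s (x s)))"
  proof (rule integral_equation_exists[where L = L])
    show "0 \<le> T" using T_pos by simp
    show "(\<lambda>t. A t *v z t + B t *v u t) integrable_on {0..T}" if "continuous_on {0..T} z" for z
      by (rule integrable_on_Linf[OF Linf_rhs[OF that u]])
    show "norm (A t *v x + B t *v u t - (A t *v y + B t *v u t)) \<le> L * norm (x - y)"
      if "t \<in> {0..T}" for t x y
      using L(2)[OF that, of "x - y"] by (simp add: matrix_vector_mult_diff_distrib)
  qed
  then show ?thesis by (simp add: solution_def)
qed

text \<open>Subtracting the two Volterra equations cancels \<open>x0\<close> and leaves a Gronwall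
  inequality with forcing \<open>D\<close>. The controls enter only through the primitives of
  \<open>B u\<close> and \<open>B v\<close>, because these, and not the norm of
  \<open>u - v\<close>, are controlled by the weak-* topology. The case \<open>D = 0\<close> is
  uniqueness.\<close>

lemma solution_dist_le:
  assumes u: "u \<in> Linf T" "solution u x" and v: "v \<in> Linf T" "solution v y"
    and D: "\<And>t. t \<in> {0..T} \<Longrightarrow>
      norm (integral {0..t} (\<lambda>s. B s *v u s) - integral {0..t} (\<lambda>s. B s *v v s)) \<le> D"
    and L: "L \<ge> 0" "\<And>t z. t \<in> {0..T} \<Longrightarrow> norm (A t *v z) \<le> L * norm z"
    and t: "t \<in> {0..T}"
  shows "norm (x t - y t) \<le> D * exp (L * t)"
proof -
  have cont: "continuous_on {0..T} x" "continuous_on {0..T} y"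
    using u v by (simp_all add: solution_def)
  have contn: "continuous_on {0..T} (\<lambda>s. norm (x s - y s))"
    by (intro continuous_intros cont)
  show ?thesis
  proof (rule gronwall[OF contn L(1) _ t])
    fix t assume t: "t \<in> {0..T}"
    then have t0: "0 \<le> (0::real)" "t \<le> T" by simp_all
    note int = integrable_on_Linf_subinterval[OF _ t0]
    have split: "integral {0..t} (\<lambda>s. A s *v z s + B s *v w s) =
        integral {0..t} (\<lambda>s. A s *v z s) + integral {0..t} (\<lambda>s. B s *v w s)"
      if "w \<in> Linf T" "continuous_on {0..T} z" for w z
      by (rule Henstock_Kurzweil_Integration.integral_add[OF int[OF Linf_A[OF that(2)]] int[OF Linf_B[OF that(1)]]])
    have "x t - y t = (integral {0..t} (\<lambda>s. A s *v x s) - integral {0..t} (\<lambda>s. A s *v y s)) +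
        (integral {0..t} (\<lambda>s. B s *v u s) - integral {0..t} (\<lambda>s. B s *v v s))"
      using u v t by (simp add: solution_def split)
    then have "norm (x t - y t) \<le> norm (integral {0..t} (\<lambda>s. A s *v x s) - integral {0..t} (\<lambda>s. A s *v y s)) + D"
      using D[OF t] norm_triangle_ineq by (smt (verit))
    also have "integral {0..t} (\<lambda>s. A s *v x s) - integral {0..t} (\<lambda>s. A s *v y s)
        = integral {0..t} (\<lambda>s. A s *v x s - A s *v y s)"
      by (rule Henstock_Kurzweil_Integration.integral_diff[symmetric, OF int[OF Linf_A[OF cont(1)]] int[OF Linf_A[OF cont(2)]]])
    also have "norm \<dots> \<le> integral {0..t} (\<lambda>s. L * norm (x s - y s))"
    proof (rule integral_norm_bound_integral)
      show "(\<lambda>s. A s *v x s - A s *v y s) integrable_on {0..t}"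
        by (rule Henstock_Kurzweil_Integration.integrable_diff[OF int[OF Linf_A[OF cont(1)]] int[OF Linf_A[OF cont(2)]]])
      show "(\<lambda>s. L * norm (x s - y s)) integrable_on {0..t}"
        by (intro integrable_continuous_interval continuous_intros continuous_on_subset[OF cont(1)]
            continuous_on_subset[OF cont(2)]) (use t in auto)
      show "norm (A s *v x s - A s *v y s) \<le> L * norm (x s - y s)" if "s \<in> {0..t}" for s
        using L(2)[of s "x s - y s"] that t by (simp add: matrix_vector_mult_diff_distrib)
    qed
    finally show "norm (x t - y t) \<le> D + L * integral {0..t} (\<lambda>s. norm (x s - y s))"
      by simp
  qed
qed

lemma solution_unique:
  assumes "u \<in> Linf T" "solution u x" "solution u y" "t \<in> {0..T}"
  shows "x t = y t"
proof -
  obtain L where L: "L \<ge> 0" "\<And>t z. t \<in> {0..T} \<Longrightarrow> norm (A t *v z) \<le> L * norm z"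
    using A_bound by blast
  have "norm (x t - y t) \<le> 0 * exp (L * t)"
    by (rule solution_dist_le[OF assms(1,2,1,3) _ L assms(4)]) simp
  then show ?thesis by simp
qed

lemma solution_cong:
  assumes "\<And>t. t \<in> {0..T} \<Longrightarrow> x t = y t"
  shows "solution u x \<longleftrightarrow> solution u y"
proof -
  have "integral {0..t} (\<lambda>s. A s *v x s + B s *v u s) = integral {0..t} (\<lambda>s. A s *v y s + B s *v u s)"
    if "t \<in> {0..T}" for t
    using that assms by (intro Henstock_Kurzweil_Integration.integral_cong) auto
  then show ?thesis
    using assms continuous_on_cong[OF refl assms, of "{0..T}"] by (simp add: solution_def)
qed

section \<open>Equivalence of Caratheodory trajectories and Volterra solutions\<close>

lemma is_trajectory_imp_solution:
  assumes x: "is_trajectory T x0 A B u x"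
  shows "solution u x"
proof -
  have ac: "absolutely_continuous_on_ivl 0 T x" and init: "x 0 = x0"
    using x by (simp_all add: is_trajectory_def)
  obtain N where N: "negligible N" "\<And>t. t \<in> {0..T} - N \<Longrightarrow>
      (x has_vector_derivative (A t *v x t + B t *v u t)) (at t within {0..T})"
    using x unfolding is_trajectory_def AE_lebesgue_on_Icc_iff by blast
  have "x t = x0 + integral {0..t} (\<lambda>s. A s *v x s + B s *v u s)" if t: "t \<in> {0..T}" for t
  proof -
    have "((\<lambda>s. A s *v x s + B s *v u s) has_integral x t - x 0) {0..t}"
    proof (rule has_integral_absolutely_continuous[OF _ _ N(1)])
      show "absolutely_continuous_on_ivl 0 t x"
        by (rule absolutely_continuous_on_ivl_subinterval[OF ac]) (use t in auto)
      show "(x has_vector_derivative (A s *v x s + B s *v u s)) (at s within {0..t})"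
        if "s \<in> {0..t} - N" for s
        by (rule has_vector_derivative_within_subset[OF N(2)]) (use that t in auto)
    qed (use t in simp)
    then show ?thesis
      by (simp add: integral_unique init)
  qed
  then show ?thesis
    using absolutely_continuous_on_ivl_imp_continuous_on[OF ac] by (simp add: solution_def)
qed

lemma solution_imp_is_trajectory:
  assumes u: "u \<in> Linf T" and x: "solution u x"
  shows "is_trajectory T x0 A B u x"
proof -
  define g where "g = (\<lambda>s. A s *v x s + B s *v u s)"
  have cont: "continuous_on {0..T} x" and eq: "\<And>t. t \<in> {0..T} \<Longrightarrow> x t = x0 + integral {0..t} g"
    using x by (simp_all add: solution_def g_def)
  have g: "g \<in> Linf T"
    unfolding g_def by (rule Linf_rhs[OF cont u])
  obtain M where M: "M \<ge> 0" "AE t in lebesgue_on {0..T}. norm (g t) \<le> M"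
    using Linf_bound[OF g] .
  \<comment> \<open>The right-hand side \<open>g\<close> is essentially bounded, so its primitive
    \<open>x\<close> is even Lipschitz.\<close>
  have "absolutely_continuous_on_ivl 0 T x"
  proof (rule absolutely_continuous_on_ivl_lipschitz)
    fix s t assume st: "0 \<le> s" "s \<le> t" "t \<le> T"
    have "x t - x s = integral {0..t} g - integral {0..s} g"
      using st by (simp add: eq)
    also have "\<dots> = integral {s..t} g"
      by (rule integral_real_diff[OF integrable_on_Linf[OF g] st])
    also have "norm \<dots> \<le> M * (t - s)"
      by (rule norm_integral_AE_le[OF integrable_on_Linf_subinterval[OF g st(1,3)] M(1) st M(2)])
    finally show "norm (x t - x s) \<le> M * (t - s)" .
  qed
  moreover have "x 0 = x0"
    using eq[of 0] T_pos by simp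
  moreover have "AE t in lebesgue_on {0..T}. (x has_vector_derivative g t) (at t within {0..T})"
    unfolding AE_lebesgue_on_Icc_iff
  proof -
    obtain N where N: "negligible N" "\<And>t. t \<in> {0..T} - N \<Longrightarrow>
        ((\<lambda>t. integral {0..t} g) has_vector_derivative g t) (at t within {0..T})"
      using has_vector_derivative_indefinite_integral_AE[OF integrable_on_Linf[OF g]] by blast
    have "(x has_vector_derivative g t) (at t within {0..T})" if t: "t \<in> {0..T} - N" for t
    proof (rule has_vector_derivative_transform)
      show "((\<lambda>t. x0 + integral {0..t} g) has_vector_derivative g t) (at t within {0..T})"
        using has_vector_derivative_add[OF has_vector_derivative_const N(2)[OF t], of x0] by simp
    qed (use t eq in auto)
    with N(1) show "\<exists>N. negligible N \<and> (\<forall>t\<in>{0..T} - N. (x has_vector_derivative g t) (at t within {0..T}))"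
      by blast
  qed
  ultimately show ?thesis
    by (simp add: is_trajectory_def g_def)
qed

section \<open>The state as a function of the control\<close>

lemma state_unique:
  assumes u: "u \<in> Linf T" and x: "solution u x" "x \<in> extensional {0..T}"
  shows "state T x0 A B u = x"
  unfolding state_def
proof (rule the_equality)
  show "x \<in> extensional {0..T} \<and> is_trajectory T x0 A B u x"
    using solution_imp_is_trajectory[OF u x(1)] x(2) by simp
  fix y assume y: "y \<in> extensional {0..T} \<and> is_trajectory T x0 A B u y"
  then have "y t = x t" if "t \<in> {0..T}" for t
    using solution_unique[OF u is_trajectory_imp_solution x(1) that] by blast
  \<comment> \<open>Uniqueness gives equality on [0,T] only; \<open>extensional\<close> settles the
    values elsewhere and thereby makes the definite description meaningful.\<close>
  then show "y = x"
    using y x(2) by (blast intro: extensionalityI)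
qed

lemma solution_state:
  assumes u: "u \<in> Linf T"
  shows "solution u (state T x0 A B u)" "state T x0 A B u \<in> extensional {0..T}"
proof -
  obtain x where x: "solution u x"
    using solution_exists[OF u] by blast
  then have "solution u (restrict x {0..T})"
    using solution_cong[of "restrict x {0..T}" x] by simp
  moreover from this have "state T x0 A B u = restrict x {0..T}"
    by (intro state_unique u) auto
  ultimately show "solution u (state T x0 A B u)" "state T x0 A B u \<in> extensional {0..T}"
    by auto
qed

lemma continuous_on_state: "u \<in> Linf T \<Longrightarrow> continuous_on {0..T} (state T x0 A B u)"
  using solution_state(1) by (simp add: solution_def)

text \<open>The Volterra equation is linear apart from \<open>x0\<close>, and \<open>x0\<close> is
  reproduced because the weights \<open>1 - r\<close> and \<open>r\<close> add up to 1; uniqueness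
  then identifies the combination as the state.\<close>

lemma state_convex_comb:
  assumes u: "u \<in> Linf T" and v: "v \<in> Linf T"
  shows "state T x0 A B (convex_comb r u v) =
    restrict (convex_comb r (state T x0 A B u) (state T x0 A B v)) {0..T}"
proof (rule state_unique)
  define x y where "x = state T x0 A B u" and "y = state T x0 A B v"
  have xy: "solution u x" "solution v y"
    unfolding x_def y_def by (intro solution_state u v)+
  have "solution (convex_comb r u v) (convex_comb r x y)"
    unfolding solution_def
  proof (intro conjI ballI)
    show "continuous_on {0..T} (convex_comb r x y)"
      using xy unfolding convex_comb_def solution_def by (intro continuous_intros) auto
    fix t assume t: "t \<in> {0..T}"
    then have int: "g integrable_on {0..t}" if "g \<in> Linf T" for g :: "real \<Rightarrow> real^'n"
      using integrable_on_Linf_subinterval[OF that, of 0 t] by simp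
    define g h where "g = (\<lambda>s. A s *v x s + B s *v u s)" and "h = (\<lambda>s. A s *v y s + B s *v v s)"
    have gh: "g integrable_on {0..t}" "h integrable_on {0..t}"
      using xy u v unfolding g_def h_def solution_def by (auto intro!: int Linf_rhs)
    have "(\<lambda>s. A s *v convex_comb r x y s + B s *v convex_comb r u v s) = (\<lambda>s. (1 - r) *\<^sub>R g s + r *\<^sub>R h s)"
      by (simp add: g_def h_def convex_comb_def matrix_vector_right_distrib matrix_vector_mult_scaleR
          scaleR_add_right add_ac fun_eq_iff)
    then have "integral {0..t} (\<lambda>s. A s *v convex_comb r x y s + B s *v convex_comb r u v s) =
        (1 - r) *\<^sub>R integral {0..t} g + r *\<^sub>R integral {0..t} h"
      using gh by (simp add: Henstock_Kurzweil_Integration.integral_add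
          Henstock_Kurzweil_Integration.integrable_cmul)
    moreover have "x t = x0 + integral {0..t} g" "y t = x0 + integral {0..t} h"
      using xy t by (simp_all add: solution_def g_def h_def)
    ultimately show "convex_comb r x y t =
        x0 + integral {0..t} (\<lambda>s. A s *v convex_comb r x y s + B s *v convex_comb r u v s)"
      by (simp add: convex_comb_def algebra_simps)
  qed
  then show "solution (convex_comb r u v) (restrict (convex_comb r (state T x0 A B u) (state T x0 A B v)) {0..T})"
    using solution_cong[of "restrict (convex_comb r x y) {0..T}" "convex_comb r x y"]
    by (simp add: x_def y_def)
qed (use u v in \<open>auto intro: Linf_convex_comb\<close>)

end

section \<open>Weak-* continuity of the state\<close>

text \<open>The space of a generated topology is the union of its generators, and the generator with
  \<open>g = 0\<close> and \<open>W = UNIV\<close> is already everything.\<close>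

lemma topspace_weak_star [simp]: "topspace (weak_star T) = Linf T"
proof -
  have "Linf T \<in> {{u \<in> Linf T. (LINT t|lebesgue_on {0..T}. g t \<bullet> u t) \<in> W} | g W.
        integrable (lebesgue_on {0..T}) (g :: real \<Rightarrow> 'a) \<and> open W}"
    by (rule CollectI, intro exI[of _ "\<lambda>_. 0"] exI[of _ UNIV]) auto
  then show ?thesis
    unfolding weak_star_def topology_generated_by_topspace by blast
qed

lemma topspace_weak_star_on [simp]: "topspace (weak_star_on T K) = Linf T \<inter> K"
  by (simp add: weak_star_on_def)

lemma continuous_map_weak_star_on_pairing:
  assumes g: "integrable (lebesgue_on {0..T}) g"
  shows "continuous_map (weak_star_on T K) euclideanreal (\<lambda>u. LINT t|lebesgue_on {0..T}. g t \<bullet> u t)"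
  unfolding weak_star_on_def
proof (rule continuous_map_from_subtopology)
  show "continuous_map (weak_star T) euclideanreal (\<lambda>u. LINT t|lebesgue_on {0..T}. g t \<bullet> u t)"
    unfolding continuous_map_def
  proof (intro conjI allI impI)
    fix W :: "real set" assume "openin euclidean W"
    then have "open W" by simp
    then show "openin (weak_star T) {u \<in> topspace (weak_star T). (LINT t|lebesgue_on {0..T}. g t \<bullet> u t) \<in> W}"
      unfolding topspace_weak_star unfolding weak_star_def
      by (intro topology_generated_by_Basis) (use g in blast)
  qed simp
qed

lemma bounded_bilinear_vector_matrix_mult:
  "bounded_bilinear ((v*) :: real^'m \<Rightarrow> real^'n^'m \<Rightarrow> real^'n)"
  unfolding bilinear_conv_bounded_bilinear[symmetric] bilinear_def
  by (auto intro!: linearI simp: vector_matrix_left_distrib vector_matrix_mult_add_rdistrib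
      scaleR_vector_matrix_assoc vector_scaleR_matrix_ac)

context linear_system
begin

text \<open>The coordinate of \<open>\<integral>\<^sub>0\<^sup>t B u\<close> along \<open>k\<close> is the pairing of \<open>u\<close> with \<open>1\<^bsub>[0,t]\<^esub> B\<^sup>T k\<close>.\<close>

lemma continuous_map_input:
  assumes t: "t \<in> {0..T}"
  shows "continuous_map (weak_star_on T K) euclidean (\<lambda>u. integral {0..t} (\<lambda>s. B s *v u s))"
proof -
  define g where "g = (\<lambda>k s. indicat_real {0..t} s *\<^sub>R (k v* B s))"
  have "indicat_real {0..t} \<in> Linf T"
    by (rule LinfI[of _ _ 1], intro measurable_restrict_space1 borel_measurable_indicator)
      (auto simp: indicator_def)
  moreover have "(\<lambda>s. k v* B s) \<in> Linf T" for k
    by (rule Linf_bilinear[OF bounded_bilinear_vector_matrix_mult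
          continuous_on_imp_Linf[OF continuous_on_const] bounded_measurable_on_imp_Linf[OF B]])
  ultimately have g: "g k \<in> Linf T" for k
    unfolding g_def by (intro Linf_bilinear[OF bounded_bilinear_scaleR])
  have eq: "(\<Sum>k\<in>Basis. (LINT s|lebesgue_on {0..T}. g k s \<bullet> u s) *\<^sub>R k) = integral {0..t} (\<lambda>s. B s *v u s)"
    if u: "u \<in> Linf T" for u
  proof -
    have int: "(\<lambda>s. B s *v u s) integrable_on {0..t}"
      by (rule integrable_on_Linf_subinterval[OF Linf_B[OF u]]) (use t in auto)
    have "(LINT s|lebesgue_on {0..T}. g k s \<bullet> u s) = integral {0..t} (\<lambda>s. B s *v u s) \<bullet> k" for k
    proof -
      have "(LINT s|lebesgue_on {0..T}. g k s \<bullet> u s) = integral {0..T} (\<lambda>s. g k s \<bullet> u s)"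
        by (rule lebesgue_integral_eq_integral[OF integrable_Linf[OF Linf_bilinear[OF bounded_bilinear_inner g u]]]) simp
      also have "\<dots> = integral {0..T} (\<lambda>s. if s \<in> {0..t} then (B s *v u s) \<bullet> k else 0)"
        by (intro Henstock_Kurzweil_Integration.integral_cong)
          (simp add: g_def dot_lmul_matrix, simp add: inner_commute)
      also have "\<dots> = integral {0..t} (\<lambda>s. (B s *v u s) \<bullet> k)"
        unfolding Henstock_Kurzweil_Integration.integral_restrict_Int using t by (simp add: Int_absorb1)
      also have "\<dots> = integral {0..t} (\<lambda>s. B s *v u s) \<bullet> k"
        by (rule integral_component_eq[OF int])
      finally show ?thesis .
    qed
    then show ?thesis by (simp add: euclidean_representation)
  qed
  have "continuous_map (weak_star_on T K) euclidean
      (\<lambda>u. \<Sum>k\<in>Basis. (LINT s|lebesgue_on {0..T}. g k s \<bullet> u s) *\<^sub>R k)"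
  proof (intro continuous_map_sum)
    fix k :: "real^'n" assume "k \<in> Basis"
    show "continuous_map (weak_star_on T K) euclidean (\<lambda>u. (LINT s|lebesgue_on {0..T}. g k s \<bullet> u s) *\<^sub>R k)"
      using continuous_map_compose[OF continuous_map_weak_star_on_pairing[OF integrable_Linf[OF g]],
          of euclidean "\<lambda>r. r *\<^sub>R k"]
      by (simp add: o_def continuous_on_scaleR)
  qed simp
  then show ?thesis
    by (rule continuous_map_eq) (simp add: eq)
qed

text \<open>This is the equicontinuity: the Lipschitz constant depends on the control only through
  the bound \<open>M\<close>, which a bounded set of controls shares.\<close>

lemma norm_input_diff_le:
  assumes u: "u \<in> Linf T" and M: "0 \<le> M" "AE s in lebesgue_on {0..T}. norm (B s *v u s) \<le> M"
    and st: "s \<in> {0..T}" "t \<in> {0..T}"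
  shows "norm (integral {0..t} (\<lambda>s. B s *v u s) - integral {0..s} (\<lambda>s. B s *v u s)) \<le> M * \<bar>t - s\<bar>"
proof -
  have *: "norm (integral {0..q} (\<lambda>s. B s *v u s) - integral {0..p} (\<lambda>s. B s *v u s)) \<le> M * (q - p)"
    if pq: "0 \<le> p" "p \<le> q" "q \<le> T" for p q
    unfolding integral_real_diff[OF integrable_on_Linf[OF Linf_B[OF u]] pq]
    by (rule norm_integral_AE_le[OF integrable_on_Linf_subinterval[OF Linf_B[OF u] pq(1,3)] M(1) pq M(2)])
  show ?thesis
  proof (cases "s \<le> t")
    case True
    then show ?thesis using *[of s t] st by simp
  next
    case False
    then show ?thesis using *[of t s] st by (simp add: norm_minus_commute)
  qed
qed

text \<open>Pointwise weak-* continuity of \<open>u \<mapsto> \<integral>\<^sub>0\<^sup>t B u\<close> is uniform in \<open>t\<close> by equicontinuity, and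
  Gronwall's inequality passes it on to the states.\<close>

lemma state_locally_uniform:
  assumes K: "K \<subseteq> Linf T" and R: "\<And>u. u \<in> K \<Longrightarrow> AE t in lebesgue_on {0..T}. norm (u t) \<le> R"
    and u: "u \<in> K" and \<epsilon>: "\<epsilon> > 0"
  shows "\<exists>N. openin (weak_star_on T K) N \<and> u \<in> N \<and>
    (\<forall>v\<in>N. \<forall>t\<in>{0..T}. norm (state T x0 A B u t - state T x0 A B v t) \<le> \<epsilon>)"
proof -
  define Y where "Y = (\<lambda>u t. integral {0..t} (\<lambda>s. B s *v u s))"
  obtain L where L: "L \<ge> 0" "\<And>t z. t \<in> {0..T} \<Longrightarrow> norm (A t *v z) \<le> L * norm z"
    using A_bound by blast
  obtain b where b: "b \<ge> 0" "AE t in lebesgue_on {0..T}. norm (B t) \<le> b"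
    using Linf_bound[OF bounded_measurable_on_imp_Linf[OF B]] .
  obtain C where C: "C \<ge> 0" "\<And>(a :: real^'m^'n) (b :: real^'m). norm (a *v b) \<le> norm a * norm b * C"
    using bounded_bilinear.nonneg_bounded[OF bounded_bilinear_matrix_vector_mult] by blast
  define M where "M = b * \<bar>R\<bar> * C"
  have M: "M \<ge> 0" using b C by (simp add: M_def)
  have BM: "AE s in lebesgue_on {0..T}. norm (B s *v v s) \<le> M" if "v \<in> K" for v
    using R[OF that] b(2)
  proof eventually_elim
    case (elim s)
    have "norm (B s *v v s) \<le> norm (B s) * norm (v s) * C" by (rule C)
    also have "\<dots> \<le> M"
      unfolding M_def using elim b C by (intro mult_right_mono mult_mono) auto
    finally show ?case .
  qed
  \<comment> \<open>The Gronwall factor is at most \<open>exp (L * T)\<close> on [0,T], so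
    primitives within \<open>D\<close> keep the states within \<open>\<epsilon>\<close>.\<close>
  define D where "D = \<epsilon> / exp (L * T)"
  have D: "D > 0" using \<epsilon> by (simp add: D_def)
  \<comment> \<open>Moving \<open>t\<close> to a net point at distance below \<open>\<eta>\<close>
    costs at most \<open>D / 4\<close> for each of the two controls, which leaves
    \<open>D / 2\<close> for the comparison at the net points. The summand 1 covers
    \<open>M = 0\<close>.\<close>
  define \<eta> where "\<eta> = D / (4 * (M + 1))"
  have \<eta>: "\<eta> > 0" using D M by (simp add: \<eta>_def)
  have M\<eta>: "M * \<eta> \<le> D / 4"
    using D M by (simp add: \<eta>_def field_simps)
  obtain k where k: "finite k" "k \<subseteq> {0..T}" "{0..T} \<subseteq> (\<Union>r\<in>k. ball r \<eta>)"
    using seq_compact_imp_totally_bounded[of "{0..T}"] compact_imp_seq_compact[OF compact_Icc] \<eta> by meson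
  \<comment> \<open>Closeness at the finitely many times of the net is an open condition, being a
    finite intersection of preimages of balls.\<close>
  define N where "N = (\<Inter>r\<in>k. {v \<in> topspace (weak_star_on T K). Y v r \<in> ball (Y u r) (D/2)}) \<inter> topspace (weak_star_on T K)"
  have N_K: "v \<in> K" "v \<in> Linf T" if "v \<in> N" for v
    using that by (auto simp: N_def)
  have "openin (weak_star_on T K) N"
    unfolding N_def Y_def
    by (intro openin_INT k openin_continuous_map_preimage[OF continuous_map_input]) (use k in auto)
  moreover have "u \<in> N"
    using u K D by (auto simp: N_def)
  moreover have "norm (state T x0 A B u t - state T x0 A B v t) \<le> \<epsilon>" if v: "v \<in> N" and t: "t \<in> {0..T}" for v t
  proof -
    have uL: "u \<in> Linf T" using u K by blast
    have "norm (state T x0 A B u t - state T x0 A B v t) \<le> D * exp (L * t)"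
    proof (rule solution_dist_le[OF uL solution_state(1)[OF uL] N_K(2)[OF v] solution_state(1)[OF N_K(2)[OF v]] _ L t])
      fix t assume t: "t \<in> {0..T}"
      obtain r where r: "r \<in> k" "dist r t < \<eta>"
        using k(3) t by auto
      have rT: "r \<in> {0..T}" using r k by blast
      have rt: "M * \<bar>t - r\<bar> \<le> D / 4"
      proof -
        have "M * \<bar>t - r\<bar> \<le> M * \<eta>"
          using r(2) M by (intro mult_left_mono) (auto simp: dist_real_def)
        then show ?thesis using M\<eta> by simp
      qed
      have 1: "norm (Y u t - Y u r) \<le> D / 4"
        using norm_input_diff_le[OF uL M BM[OF u] rT t] rt unfolding Y_def by linarith
      have 2: "norm (Y v t - Y v r) \<le> D / 4"
        using norm_input_diff_le[OF N_K(2)[OF v] M BM[OF N_K(1)[OF v]] rT t] rt unfolding Y_def by linarith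
      have 3: "norm (Y u r - Y v r) \<le> D / 2"
        using v r by (auto simp: N_def dist_norm)
      have "Y u t - Y v t = (Y u t - Y u r) + (Y u r - Y v r) - (Y v t - Y v r)" by simp
      also have "norm \<dots> \<le> norm (Y u t - Y u r) + norm (Y u r - Y v r) + norm (Y v t - Y v r)"
        by (meson add_right_mono norm_triangle_ineq norm_triangle_ineq4 order_trans)
      also have "\<dots> \<le> D" using 1 2 3 by simp
      finally show "norm (integral {0..t} (\<lambda>s. B s *v u s) - integral {0..t} (\<lambda>s. B s *v v s)) \<le> D"
        by (simp add: Y_def)
    qed
    also have "\<dots> \<le> D * exp (L * T)"
      using D L t by (intro mult_left_mono) (auto intro: mult_left_mono)
    also have "\<dots> = \<epsilon>" by (simp add: D_def)
    finally show ?thesis .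
  qed
  ultimately show ?thesis by blast
qed

text \<open>Over a compact domain the boundedness demanded by \<open>cfunspace\<close> is automatic,
  which leaves continuity and extensionality.\<close>

lemma state_in_C_space:
  assumes u: "u \<in> Linf T"
  shows "state T x0 A B u \<in> mspace (C_space T)"
proof -
  have "compactin (top_of_set {0..T}) (topspace (top_of_set {0..T}))"
    by (simp add: compactin_subtopology)
  then show ?thesis
    using continuous_on_state[OF u] solution_state(2)[OF u]
    by (simp only: C_space_def compactin_mspace_cfunspace) simp
qed

lemma continuous_map_state:
  assumes K: "K \<subseteq> Linf T" and R: "\<And>u. u \<in> K \<Longrightarrow> AE t in lebesgue_on {0..T}. norm (u t) \<le> R"
  shows "continuous_map (weak_star_on T K) (mtopology_of (C_space T)) (state T x0 A B)"
  unfolding mtopology_of_def Metric_space.continuous_map_to_metric[OF Metric_space_mspace_mdist]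
proof (intro ballI allI impI)
  \<comment> \<open>The estimate is used with \<open>\<epsilon>/2\<close> because a supremum
    inherits only a non-strict bound, while the ball is open.\<close>
  fix u and \<epsilon> :: real assume "u \<in> topspace (weak_star_on T K)" and \<epsilon>: "\<epsilon> > 0"
  then have u: "u \<in> K" by simp
  obtain N where N: "openin (weak_star_on T K) N" "u \<in> N"
    "\<And>v t. v \<in> N \<Longrightarrow> t \<in> {0..T} \<Longrightarrow> norm (state T x0 A B u t - state T x0 A B v t) \<le> \<epsilon>/2"
    using state_locally_uniform[OF K R u, of "\<epsilon>/2"] \<epsilon> by auto
  have "state T x0 A B v \<in> Metric_space.mball (mspace (C_space T)) (mdist (C_space T)) (state T x0 A B u) \<epsilon>"
    if v: "v \<in> N" for v
  proof -
    have "v \<in> Linf T" using openin_subset[OF N(1)] v by auto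
    moreover have "mdist (C_space T) (state T x0 A B u) (state T x0 A B v) \<le> \<epsilon>/2"
      unfolding C_space_def using \<epsilon> N(3)[OF v] by (intro mdist_cfunspace_le) (auto simp: dist_norm)
    ultimately show ?thesis
      using K u \<epsilon> by (auto simp: Metric_space.in_mball[OF Metric_space_mspace_mdist] intro!: state_in_C_space)
  qed
  with N(1,2) show "\<exists>N. openin (weak_star_on T K) N \<and> u \<in> N \<and> (\<forall>v\<in>N. state T x0 A B v \<in>
      Metric_space.mball (mspace (C_space T)) (mdist (C_space T)) (state T x0 A B u) \<epsilon>)"
    by blast
qed

text \<open>This integral depends on \<open>u\<close> through the state and is not literally one of
  the defining pairings; it is continuous because uniformly close states give close integrals when
  \<open>a\<close> is essentially bounded.\<close>

lemma continuous_map_state_functional: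
  assumes K: "K \<subseteq> Linf T" and R: "\<And>u. u \<in> K \<Longrightarrow> AE t in lebesgue_on {0..T}. norm (u t) \<le> R"
    and a: "a \<in> Linf T"
  shows "continuous_map (weak_star_on T K) euclideanreal (\<lambda>u. LINT t|lebesgue_on {0..T}. a t \<bullet> state T x0 A B u t)"
  unfolding mtopology_is_euclidean[symmetric] Met_TC.continuous_map_to_metric
proof (intro ballI allI impI)
  fix u and \<epsilon> :: real assume "u \<in> topspace (weak_star_on T K)" and \<epsilon>: "\<epsilon> > 0"
  then have u: "u \<in> K" by simp
  obtain M where M: "M \<ge> 0" "AE t in lebesgue_on {0..T}. norm (a t) \<le> M"
    using Linf_bound[OF a] .
  \<comment> \<open>\<open>M * T\<close> is the Lipschitz constant of the functional in the supremum
    norm; the 1 keeps the divisor positive, and the 2 in \<open>e\<close> makes the final inequality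
    strict.\<close>
  define P where "P = M * T + 1"
  define e where "e = \<epsilon> / (2 * P)"
  have P: "P > 0" using M(1) T_pos by (simp add: P_def add_nonneg_pos)
  have e: "e > 0" using \<epsilon> P by (simp add: e_def)
  obtain N where N: "openin (weak_star_on T K) N" "u \<in> N"
    "\<And>v t. v \<in> N \<Longrightarrow> t \<in> {0..T} \<Longrightarrow> norm (state T x0 A B u t - state T x0 A B v t) \<le> e"
    using state_locally_uniform[OF K R u e] by auto
  have int: "(\<lambda>t. a t \<bullet> state T x0 A B v t) \<in> Linf T" if "v \<in> Linf T" for v
    by (rule Linf_bilinear[OF bounded_bilinear_inner a continuous_on_imp_Linf[OF continuous_on_state[OF that]]])
  have "(LINT t|lebesgue_on {0..T}. a t \<bullet> state T x0 A B v t) \<in>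
      Met_TC.mball (LINT t|lebesgue_on {0..T}. a t \<bullet> state T x0 A B u t) \<epsilon>" if v: "v \<in> N" for v
  proof -
    have vL: "v \<in> Linf T" and uL: "u \<in> Linf T" using openin_subset[OF N(1)] v u K by auto
    note iu = integrable_Linf[OF int[OF uL]] and iv = integrable_Linf[OF int[OF vL]]
    have "norm ((LINT t|lebesgue_on {0..T}. a t \<bullet> state T x0 A B u t) - (LINT t|lebesgue_on {0..T}. a t \<bullet> state T x0 A B v t))
        = norm (LINT t|lebesgue_on {0..T}. a t \<bullet> state T x0 A B u t - a t \<bullet> state T x0 A B v t)"
      using iu iv by simp
    also have "\<dots> \<le> (LINT t|lebesgue_on {0..T}. norm (a t \<bullet> state T x0 A B u t - a t \<bullet> state T x0 A B v t))"
      by (rule integral_norm_bound)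
    also have "\<dots> \<le> (LINT t|lebesgue_on {0..T}. M * e)"
    proof (rule integral_mono_AE)
      show "integrable (lebesgue_on {0..T}) (\<lambda>t. norm (a t \<bullet> state T x0 A B u t - a t \<bullet> state T x0 A B v t))"
        by (intro integrable_norm Bochner_Integration.integrable_diff iu iv)
      show "AE t in lebesgue_on {0..T}. norm (a t \<bullet> state T x0 A B u t - a t \<bullet> state T x0 A B v t) \<le> M * e"
        using M(2) AE_lebesgue_on_self
      proof eventually_elim
        case (elim t)
        have "norm (a t \<bullet> state T x0 A B u t - a t \<bullet> state T x0 A B v t)
            \<le> norm (a t) * norm (state T x0 A B u t - state T x0 A B v t)"
          unfolding inner_diff_right[symmetric] real_norm_def by (rule Cauchy_Schwarz_ineq2)
        also have "\<dots> \<le> M * e"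
          using elim M(1) N(3)[OF v] by (intro mult_mono) auto
        finally show ?case .
      qed
    qed simp
    also have "\<dots> = M * e * T"
      using T_pos by (simp add: measure_restrict_space)
    also have "\<dots> \<le> P * e"
      using e by (simp add: P_def algebra_simps)
    also have "\<dots> < \<epsilon>"
      using \<epsilon> P by (simp add: e_def)
    finally show ?thesis by (simp add: dist_norm)
  qed
  with N(1,2) show "\<exists>N. openin (weak_star_on T K) N \<and> u \<in> N \<and>
      (\<forall>v\<in>N. (LINT t|lebesgue_on {0..T}. a t \<bullet> state T x0 A B v t) \<in>
        Met_TC.mball (LINT t|lebesgue_on {0..T}. a t \<bullet> state T x0 A B u t) \<epsilon>)"
    by blast
qed

end

section \<open>Payoff and constraint\<close>

text \<open>Values on the null set where continuity fails are set to \<open>0\<close>, which is harmless because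
  Lebesgue measure is complete; then \<open>w\<close> can be approximated by simple functions.\<close>

lemma borel_measurable_Caratheodory:
  fixes g :: "real \<Rightarrow> 'a::euclidean_space \<Rightarrow> real"
  assumes meas: "\<And>z. (\<lambda>t. g t z) \<in> borel_measurable (lebesgue_on {a..b})"
    and cont: "AE t in lebesgue_on {a..b}. continuous_on UNIV (g t)"
    and w: "w \<in> borel_measurable (lebesgue_on {a..b})"
  shows "(\<lambda>t. g t (w t)) \<in> borel_measurable (lebesgue_on {a..b})"
proof -
  obtain N where N: "negligible N" "\<And>t. t \<in> {a..b} - N \<Longrightarrow> continuous_on UNIV (g t)"
    using cont unfolding AE_lebesgue_on_Icc_iff by blast
  have Nset: "N \<in> sets lebesgue" "N \<in> null_sets lebesgue"
    using N(1) negligible_iff_null_sets negligible_imp_sets by auto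
  define h where "h = (\<lambda>t z. if t \<in> - N then g t z else 0)"
  have hm: "(\<lambda>t. h t z) \<in> borel_measurable (lebesgue_on {a..b})" for z
  proof -
    have "{t \<in> space (lebesgue_on {a..b}). t \<in> - N} \<in> sets (lebesgue_on {a..b})"
      using sets.compl_sets[OF Nset(1)]
      by (auto simp: sets_restrict_space Compl_eq_Diff_UNIV intro!: image_eqI[of _ _ "UNIV - N"])
    then show ?thesis
      unfolding h_def by (intro measurable_If meas) auto
  qed
  have hc: "continuous_on UNIV (h t)" if "t \<in> {a..b}" for t
    using N(2)[of t] that by (cases "t \<in> N") (simp_all add: h_def)
  obtain F where F: "\<And>i. simple_function (lebesgue_on {a..b}) (F i)"
    "\<And>t. t \<in> space (lebesgue_on {a..b}) \<Longrightarrow> (\<lambda>i. F i t) \<longlonglongrightarrow> w t"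
    using borel_measurable_implies_sequence_metric[OF w, of 0] by blast
  have "(\<lambda>t. h t (w t)) \<in> borel_measurable (lebesgue_on {a..b})"
  proof (rule borel_measurable_LIMSEQ_real)
    show "(\<lambda>i. h t (F i t)) \<longlonglongrightarrow> h t (w t)" if "t \<in> space (lebesgue_on {a..b})" for t
      using continuous_on_tendsto_compose[OF hc F(2)[OF that]] that by simp
    show "(\<lambda>t. h t (F i t)) \<in> borel_measurable (lebesgue_on {a..b})" for i
    \<comment> \<open>\<open>F i\<close> takes finitely many values, so the composition is pieced
      together from the measurable sections of \<open>h\<close> at these values.\<close>
    proof (rule measurable_compose_countable'[where I = "F i ` space (lebesgue_on {a..b})"])
      have fin: "finite (F i ` space (lebesgue_on {a..b}))"
        using F(1) by (rule simple_functionD)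
      then show "countable (F i ` space (lebesgue_on {a..b}))"
        by (rule countable_finite)
      show "F i \<in> measurable (lebesgue_on {a..b}) (count_space (F i ` space (lebesgue_on {a..b})))"
        unfolding measurable_count_space_eq2[OF fin] using simple_functionD[OF F(1)] by blast
    qed (rule hm)
  qed
  \<comment> \<open>Extension by 0 moves to the complete measure \<open>lebesgue\<close>, where
    replacing \<open>h\<close> by \<open>g\<close> on the null set \<open>N\<close> preserves
    measurability.\<close>
  then have "(\<lambda>t. if t \<in> {a..b} then h t (w t) else 0) \<in> borel_measurable lebesgue"
    by (intro borel_measurable_if[THEN iffD2]) simp_all
  moreover have "AE t in lebesgue. (if t \<in> {a..b} then h t (w t) else 0) = (if t \<in> {a..b} then g t (w t) else 0)"
    by (rule AE_I'[OF Nset(2)]) (auto simp: h_def)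
  ultimately have "(\<lambda>t. if t \<in> {a..b} then g t (w t) else 0) \<in> borel_measurable lebesgue"
    by (rule borel_measurable_AE)
  then show ?thesis
    by (rule borel_measurable_if[THEN iffD1, rotated]) simp
qed

lemma C1_fun_imp_continuous_on: "C1_fun g \<Longrightarrow> continuous_on UNIV g"
  unfolding C1_fun_def
  by (blast intro: continuous_at_imp_continuous_on has_derivative_continuous)

lemma admissible_subset_Linf: "admissible T U \<subseteq> Linf T"
  by (auto simp: admissible_def)

lemma convex_fun_set_admissible:
  assumes U: "convex U"
  shows "convex_fun_set (admissible T U)"
  unfolding convex_fun_set_def
proof (intro ballI)
  fix u v and s :: real
  assume u: "u \<in> admissible T U" and v: "v \<in> admissible T U" and s: "s \<in> {0..1}"
  have "AE t in lebesgue_on {0..T}. u t \<in> U" "AE t in lebesgue_on {0..T}. v t \<in> U"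
    using u v by (simp_all add: admissible_def)
  then have "AE t in lebesgue_on {0..T}. convex_comb s u v t \<in> U"
  proof eventually_elim
    case (elim t)
    then show ?case
      unfolding convex_comb_def using s by (intro convexD[OF U]) auto
  qed
  then show "convex_comb s u v \<in> admissible T U"
    using u v by (simp add: admissible_def Linf_convex_comb)
qed

context linear_system
begin

text \<open>The state is bounded on the compact [0,T] and the control is a.e. in the bounded set
  \<open>U\<close>, so the growth condition makes the integrand essentially bounded.\<close>

lemma integrable_running_payoff:
  fixes f :: "real \<Rightarrow> real^'n \<Rightarrow> real^'m \<Rightarrow> real"
  assumes U: "bounded U"
    and f_measurable: "\<And>x u. (\<lambda>t. f t x u) \<in> borel_measurable (lebesgue_on {0..T})"
    and f_cont: "AE t in lebesgue_on {0..T}. continuous_on UNIV (\<lambda>(x, u). f t x u)"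
    and f_growth:
      "\<And>t x u. \<lbrakk>t \<in> {0..T}; u \<in> U\<rbrakk> \<Longrightarrow> \<bar>f t x u\<bar> \<le> c * (1 + (norm x)\<^sup>2 + (norm u)\<^sup>2)"
    and u: "u \<in> admissible T U"
  shows "integrable (lebesgue_on {0..T}) (\<lambda>t. f t (state T x0 A B u t) (u t))"
proof (rule integrable_Linf)
  have uL: "u \<in> Linf T" using u admissible_subset_Linf by blast
  let ?x = "state T x0 A B u"
  have cont: "continuous_on {0..T} ?x" by (rule continuous_on_state[OF uL])
  have "bounded (?x ` {0..T})"
    by (intro compact_imp_bounded compact_continuous_image cont compact_Icc)
  then obtain X where X: "\<forall>y\<in>?x ` {0..T}. norm y \<le> X"
    unfolding bounded_iff ..
  obtain R where R: "\<forall>x\<in>U. norm x \<le> R"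
    using U unfolding bounded_iff ..
  show "(\<lambda>t. f t (?x t) (u t)) \<in> Linf T"
  proof (rule LinfI)
    have w: "(\<lambda>t. (?x t, u t)) \<in> borel_measurable (lebesgue_on {0..T})"
      by (intro borel_measurable_Pair Linf_measurable[OF uL] Linf_measurable[OF continuous_on_imp_Linf[OF cont]])
    have "(\<lambda>t. (case z of (x, u) \<Rightarrow> f t x u)) \<in> borel_measurable (lebesgue_on {0..T})" for z
      by (simp add: split_def f_measurable)
    from borel_measurable_Caratheodory[OF this f_cont w]
    show "(\<lambda>t. f t (?x t) (u t)) \<in> borel_measurable (lebesgue_on {0..T})"
      by simp
    have "AE t in lebesgue_on {0..T}. u t \<in> U"
      using u by (simp add: admissible_def)
    then show "AE t in lebesgue_on {0..T}. norm (f t (?x t) (u t)) \<le> \<bar>c\<bar> * (1 + X\<^sup>2 + R\<^sup>2)"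
      using AE_lebesgue_on_self
    proof eventually_elim
      case (elim t)
      have x: "norm (?x t) \<le> X" using X elim by blast
      have "\<bar>f t (?x t) (u t)\<bar> \<le> c * (1 + (norm (?x t))\<^sup>2 + (norm (u t))\<^sup>2)"
        by (rule f_growth) (use elim in auto)
      also have "\<dots> \<le> \<bar>c\<bar> * (1 + X\<^sup>2 + R\<^sup>2)"
        using x R elim(1) by (intro mult_mono add_mono power_mono) auto
      finally show ?case by simp
    qed
  qed
qed

lemma state_convex_comb_eq:
  assumes "u \<in> Linf T" "v \<in> Linf T" "t \<in> {0..T}"
  shows "state T x0 A B (convex_comb s u v) t =
    (1 - s) *\<^sub>R state T x0 A B u t + s *\<^sub>R state T x0 A B v t"
  using assms by (simp add: state_convex_comb) (simp add: convex_comb_def)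

text \<open>Concavity of \<open>f\<close> is applied at almost every time to the pairs of state and
  control, which form a convex combination since the state is affine. Integrability lets the
  pointwise inequality be integrated; without it the integral would be 0 by convention.\<close>

lemma concave_payoff:
  fixes f :: "real \<Rightarrow> real^'n \<Rightarrow> real^'m \<Rightarrow> real"
  assumes U: "bounded U" "convex U"
    and f_measurable: "\<And>x u. (\<lambda>t. f t x u) \<in> borel_measurable (lebesgue_on {0..T})"
    and f_cont: "AE t in lebesgue_on {0..T}. continuous_on UNIV (\<lambda>(x, u). f t x u)"
    and f_concave: "AE t in lebesgue_on {0..T}. concave_on UNIV (\<lambda>(x, u). f t x u)"
    and f_growth:
      "\<And>t x u. \<lbrakk>t \<in> {0..T}; u \<in> U\<rbrakk> \<Longrightarrow> \<bar>f t x u\<bar> \<le> c * (1 + (norm x)\<^sup>2 + (norm u)\<^sup>2)"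
    and \<phi>_concave: "concave_on UNIV \<phi>"
  shows "concave_functional_on (admissible T U) (payoff T x0 A B f \<phi>)"
  unfolding concave_functional_on_def
proof (intro conjI ballI)
  show conv: "convex_fun_set (admissible T U)"
    by (rule convex_fun_set_admissible[OF U(2)])
  fix u v and s :: real
  assume u: "u \<in> admissible T U" and v: "v \<in> admissible T U" and s: "s \<in> {0..1}"
  define w where "w = convex_comb s u v"
  have w: "w \<in> admissible T U"
    using conv u v s unfolding w_def convex_fun_set_def by blast
  have uv: "u \<in> Linf T" "v \<in> Linf T"
    using u v admissible_subset_Linf by auto
  let ?x = "state T x0 A B"
  let ?F = "\<lambda>u t. f t (?x u t) (u t)"
  have int: "integrable (lebesgue_on {0..T}) (?F u)" if "u \<in> admissible T U" for u
    using integrable_running_payoff[OF U(1) f_measurable f_cont f_growth that] .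
  have "(1 - s) * (LINT t|lebesgue_on {0..T}. ?F u t) + s * (LINT t|lebesgue_on {0..T}. ?F v t)
      = (LINT t|lebesgue_on {0..T}. (1 - s) * ?F u t + s * ?F v t)"
    using int[OF u] int[OF v] by simp
  also have "\<dots> \<le> (LINT t|lebesgue_on {0..T}. ?F w t)"
  proof (rule integral_mono_AE)
    show "integrable (lebesgue_on {0..T}) (\<lambda>t. (1 - s) * ?F u t + s * ?F v t)"
      using int[OF u] int[OF v] by simp
    show "AE t in lebesgue_on {0..T}. (1 - s) * ?F u t + s * ?F v t \<le> ?F w t"
      using f_concave AE_lebesgue_on_self
    proof eventually_elim
      case (elim t)
      show ?case
        using concave_onD[OF elim(1), of s "(?x u t, u t)" "(?x v t, v t)"] s
          state_convex_comb_eq[OF uv elim(2), of s]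
        by (simp add: w_def convex_comb_def)
    qed
  qed (rule int[OF w])
  finally have 1: "(1 - s) * (LINT t|lebesgue_on {0..T}. ?F u t) + s * (LINT t|lebesgue_on {0..T}. ?F v t)
      \<le> (LINT t|lebesgue_on {0..T}. ?F w t)" .
  have 2: "(1 - s) * \<phi> (?x u T) + s * \<phi> (?x v T) \<le> \<phi> (?x w T)"
    using concave_onD[OF \<phi>_concave, of s "?x u T" "?x v T"] s T_pos
    by (simp add: w_def state_convex_comb_eq[OF uv])
  show "(1 - s) * payoff T x0 A B f \<phi> u + s * payoff T x0 A B f \<phi> v \<le> payoff T x0 A B f \<phi> (convex_comb s u v)"
    using add_mono[OF 1 2] by (simp add: payoff_def w_def algebra_simps)
qed

text \<open>Separates what needs different continuity arguments: a functional of the state, a weak-*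
  pairing with \<open>b\<close>, and a constant.\<close>

lemma constraint_eq:
  assumes a: "bounded_measurable_on T a" and b: "bounded_measurable_on T b"
    and c0: "bounded_measurable_on T c0" and u: "u \<in> Linf T"
  shows "constraint T x0 A B a b c0 u = (LINT t|lebesgue_on {0..T}. a t \<bullet> state T x0 A B u t) +
    (LINT t|lebesgue_on {0..T}. b t \<bullet> u t) + (LINT t|lebesgue_on {0..T}. c0 t)"
proof -
  have "integrable (lebesgue_on {0..T}) (\<lambda>t. a t \<bullet> state T x0 A B u t)"
    by (intro integrable_Linf Linf_bilinear[OF bounded_bilinear_inner] continuous_on_imp_Linf
        bounded_measurable_on_imp_Linf a continuous_on_state u)
  moreover have "integrable (lebesgue_on {0..T}) (\<lambda>t. b t \<bullet> u t)"
    by (intro integrable_Linf Linf_bilinear[OF bounded_bilinear_inner] bounded_measurable_on_imp_Linf b u)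
  moreover have "integrable (lebesgue_on {0..T}) c0"
    by (intro integrable_Linf bounded_measurable_on_imp_Linf c0)
  ultimately show ?thesis
    by (simp add: constraint_def)
qed

lemma affine_constraint:
  assumes U: "convex U" and a: "bounded_measurable_on T a" and b: "bounded_measurable_on T b"
    and c0: "bounded_measurable_on T c0"
  shows "affine_functional_on (admissible T U) (constraint T x0 A B a b c0)"
  unfolding affine_functional_on_def
proof (intro conjI ballI)
  show "convex_fun_set (admissible T U)"
    by (rule convex_fun_set_admissible[OF U])
  fix u v and s :: real
  assume "u \<in> admissible T U" "v \<in> admissible T U" and s: "s \<in> {0..1}"
  then have uv: "u \<in> Linf T" "v \<in> Linf T"
    using admissible_subset_Linf by auto
  let ?x = "state T x0 A B" and ?M = "lebesgue_on {0..T}"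
  define h where "h = (\<lambda>u t. a t \<bullet> ?x u t + b t \<bullet> u t + c0 t)"
  have int: "integrable ?M (h u)" if "u \<in> Linf T" for u
    unfolding h_def
    by (intro integrable_Linf Linf_add Linf_bilinear[OF bounded_bilinear_inner] continuous_on_imp_Linf
        bounded_measurable_on_imp_Linf a b c0 continuous_on_state that)
  have "integral\<^sup>L ?M (h (convex_comb s u v)) = (LINT t|?M. (1 - s) * h u t + s * h v t)"
  proof (rule Bochner_Integration.integral_cong[OF refl])
    fix t assume "t \<in> space ?M"
    then have "t \<in> {0..T}" by simp
    then show "h (convex_comb s u v) t = (1 - s) * h u t + s * h v t"
      unfolding h_def state_convex_comb_eq[OF uv \<open>t \<in> {0..T}\<close>]
      by (simp add: convex_comb_def[of s u v] inner_add_right algebra_simps)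
  qed
  also have "\<dots> = (1 - s) * integral\<^sup>L ?M (h u) + s * integral\<^sup>L ?M (h v)"
    using int[OF uv(1)] int[OF uv(2)] by simp
  finally show "constraint T x0 A B a b c0 (convex_comb s u v) =
      (1 - s) * constraint T x0 A B a b c0 u + s * constraint T x0 A B a b c0 v"
    by (simp add: constraint_def h_def)
qed

end

theorem lemma3p4:
  fixes T c :: real
    and x0 :: "real^'n"
    and U :: "(real^'m) set"
    and A :: "real \<Rightarrow> real^'n^'n"
    and B :: "real \<Rightarrow> real^'m^'n"
    and f :: "real \<Rightarrow> real^'n \<Rightarrow> real^'m \<Rightarrow> real"
    and \<phi> :: "real^'n \<Rightarrow> real"
    and a :: "real \<Rightarrow> real^'n"
    and b :: "real \<Rightarrow> real^'m"
    and c0 :: "real \<Rightarrow> real"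
  assumes T_pos: "T > 0"
    and U_nonempty: "U \<noteq> {}"
    and U_compact: "compact U"
    and U_convex: "convex U"
    and A: "bounded_measurable_on T A"
    and B: "bounded_measurable_on T B"
    and f_measurable:
      "\<And>x u. (\<lambda>t. f t x u) \<in> borel_measurable (lebesgue_on {0..T})"
    and f_C1: "AE t in lebesgue_on {0..T}. C1_fun (\<lambda>(x, u). f t x u)"
    and f_concave: "AE t in lebesgue_on {0..T}. concave_on UNIV (\<lambda>(x, u). f t x u)"
    and f_usc:
      "AE t in lebesgue_on {0..T}. upper_semicontinuous_map euclidean (\<lambda>(x, u). f t x u)"
    and c_pos: "c > 0"
    and f_growth:
      "\<And>t x u. \<lbrakk>t \<in> {0..T}; u \<in> U\<rbrakk> \<Longrightarrow> \<bar>f t x u\<bar> \<le> c * (1 + (norm x)\<^sup>2 + (norm u)\<^sup>2)"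
    and \<phi>_C1: "C1_fun \<phi>"
    and \<phi>_concave: "concave_on UNIV \<phi>"
    and \<phi>_usc: "upper_semicontinuous_map euclidean \<phi>"
    and \<phi>_growth: "\<And>x. \<bar>\<phi> x\<bar> \<le> c * (1 + (norm x)\<^sup>2)"
    and J_usc:
      "upper_semicontinuous_map (weak_star_on T (admissible T U)) (payoff T x0 A B f \<phi>)"
    and a: "bounded_measurable_on T a"
    and b: "bounded_measurable_on T b"
    and c0: "bounded_measurable_on T c0"
  shows "affine_operator_on T (admissible T U) (state T x0 A B)
    \<and> continuous_map (weak_star_on T (admissible T U)) (mtopology_of (C_space T))
           (state T x0 A B)
    \<and> concave_functional_on (admissible T U) (payoff T x0 A B f \<phi>)
    \<and> upper_semicontinuous_map (weak_star_on T (admissible T U)) (payoff T x0 A B f \<phi>)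
    \<and> affine_functional_on (admissible T U) (constraint T x0 A B a b c0)
    \<and> continuous_map (weak_star_on T (admissible T U)) euclideanreal
           (constraint T x0 A B a b c0)"
proof -
  interpret linear_system T x0 A B
    using T_pos A B by unfold_locales
  have U_bounded: "bounded U"
    by (rule compact_imp_bounded[OF U_compact])
  then obtain R where R: "\<forall>x\<in>U. norm x \<le> R"
    unfolding bounded_iff ..
  \<comment> \<open>Compactness of \<open>U\<close> supplies one bound for all admissible controls,
    as the equicontinuity requires.\<close>
  have adm_bound: "AE t in lebesgue_on {0..T}. norm (u t) \<le> R" if "u \<in> admissible T U" for u
  proof -
    have "AE t in lebesgue_on {0..T}. u t \<in> U"
      using that by (simp add: admissible_def)
    then show ?thesis
      by eventually_elim (use R in blast)
  qed
  have "affine_operator_on T (admissible T U) (state T x0 A B)"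
    unfolding affine_operator_on_def
    using convex_fun_set_admissible[OF U_convex] admissible_subset_Linf
    by (auto intro!: state_convex_comb)
  moreover have "continuous_map (weak_star_on T (admissible T U)) (mtopology_of (C_space T)) (state T x0 A B)"
    by (rule continuous_map_state[OF admissible_subset_Linf adm_bound])
  moreover have "concave_functional_on (admissible T U) (payoff T x0 A B f \<phi>)"
  proof (rule concave_payoff[OF U_bounded U_convex f_measurable _ f_concave f_growth \<phi>_concave])
    show "AE t in lebesgue_on {0..T}. continuous_on UNIV (\<lambda>(x, u). f t x u)"
      using f_C1 by eventually_elim (rule C1_fun_imp_continuous_on)
  qed
  moreover have "affine_functional_on (admissible T U) (constraint T x0 A B a b c0)"
    by (rule affine_constraint[OF U_convex a b c0])
  moreover have "continuous_map (weak_star_on T (admissible T U)) euclideanreal (constraint T x0 A B a b c0)"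
  proof (rule continuous_map_eq)
    show "continuous_map (weak_star_on T (admissible T U)) euclideanreal
        (\<lambda>u. (LINT t|lebesgue_on {0..T}. a t \<bullet> state T x0 A B u t) +
          (LINT t|lebesgue_on {0..T}. b t \<bullet> u t) + (LINT t|lebesgue_on {0..T}. c0 t))"
      by (intro continuous_map_add continuous_map_const[THEN iffD2]
          continuous_map_state_functional[OF admissible_subset_Linf adm_bound]
          continuous_map_weak_star_on_pairing integrable_Linf bounded_measurable_on_imp_Linf a b) auto
  qed (simp add: constraint_eq[OF a b c0])
  \<comment> \<open>The remaining conjunct, upper semicontinuity of the payoff, is the
    structured-class hypothesis \<open>J_usc\<close>.\<close>
  ultimately show ?thesis
    using J_usc by blast
qed

end
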